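(* Let $p \in (1, \infty)$. Let $A$ be an approximately unital $L^p$-operator algebra and denote the identity of its multiplier unitization $A^1$ by $1$. (1) Let $(e_t)_{t \in \Lambda}$ be a cai in $A$. If $\psi \colon A^1 \to \mathbb{C}$ is a (bounded linear) functional on $A^1$, then $\lim_t \psi(e_t) = \psi(1)$ if and only if $\|\psi\| = \|\psi|_A\|$. (2) $A$ is Hahn-Banach smooth in $A^1$.
   Context: An $L^p$-operator algebra is a (complex) Banach algebra isometrically isomorphic to a norm closed subalgebra of $B(L^p(X,\mu))$ for some measure space $(X,\mu)$. A unital Banach algebra is one with an identity of norm $1$. A cai is a contractive approximate identity (a net $(e_t)$ with $\|e_t\|\le1$, $e_ta\to a$, $ae_t\to a$ for all $a$). Approximately unital means having a cai. Multiplier unitization: for a nonunital approximately unital Banach algebra $A$, $A^1 = A + \mathbb{C}1$ with norm $\|a+\lambda 1\| = \sup\{\|ac+\lambda c\| : c \in A, \|c\|\le 1\}$; if $A$ is unital, $A^1 = A$. A closed subspace $M$ of a Banach space $E$ is Hahn-Banach smooth in $E$ if for every $\omega_0\in M^*$ there is a unique $\omega\in E^*$ with $\|\omega\|=\|\omega_0\|$ and $\omega|_M=\omega_0$. *)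

theory Defs
  imports "HOL-Analysis.Analysis"
begin

section \<open>Complex Banach algebras\<close>

text \<open>The real scalar multiplication of the library classes is required to be the
  restriction of the complex one. No identity element is assumed.\<close>

class complex_banach_algebra = real_normed_algebra + banach +
  fixes scaleC :: "complex \<Rightarrow> 'a \<Rightarrow> 'a"
  assumes scaleC_add_right: "scaleC c (x + y) = scaleC c x + scaleC c y"
    and scaleC_add_left: "scaleC (c + d) x = scaleC c x + scaleC d x"
    and scaleC_scaleC: "scaleC c (scaleC d x) = scaleC (c * d) x"
    and scaleC_of_real: "scaleC (complex_of_real r) x = scaleR r x"
    and mult_scaleC_left: "scaleC c x * y = scaleC c (x * y)"
    and mult_scaleC_right: "x * scaleC c y = scaleC c (x * y)"
    and norm_scaleC: "norm (scaleC c x) = cmod c * norm x"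

section \<open>Normed spaces with explicit carrier\<close>

text \<open>The spaces \<open>L\<^sup>p(M)\<close>, their operator spaces and the unitization depend on terms and so
  cannot be types. They are packaged as a carrier set together with its operations.\<close>

record 'b cspace =
  vecs :: "'b set"
  vadd :: "'b \<Rightarrow> 'b \<Rightarrow> 'b"
  vscale :: "complex \<Rightarrow> 'b \<Rightarrow> 'b"
  vnorm :: "'b \<Rightarrow> real"

definition scalars :: "complex cspace" where
  "scalars = \<lparr>vecs = UNIV, vadd = (+), vscale = (*), vnorm = cmod\<rparr>"

definition vdist :: "'b cspace \<Rightarrow> 'b \<Rightarrow> 'b \<Rightarrow> real" where
  "vdist X x y = vnorm X (vadd X x (vscale X (- 1) y))"

definition subspace_on :: "'b cspace \<Rightarrow> 'b set \<Rightarrow> 'b cspace" where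
  "subspace_on X S = X\<lparr>vecs := S\<rparr>"

definition closed_subspace :: "'b cspace \<Rightarrow> 'b set \<Rightarrow> bool" where
  "closed_subspace X S \<longleftrightarrow>
     S \<subseteq> vecs X \<and> S \<noteq> {} \<and>
     (\<forall>x\<in>S. \<forall>y\<in>S. vadd X x y \<in> S) \<and>
     (\<forall>c. \<forall>x\<in>S. vscale X c x \<in> S) \<and>
     (\<forall>s. \<forall>x\<in>vecs X. (\<forall>n::nat. s n \<in> S) \<and> (\<lambda>n. vdist X (s n) x) \<longlonglongrightarrow> 0 \<longrightarrow> x \<in> S)"

text \<open>Operators are extensional functions, so that equality of operators is equality on the
  carrier.\<close>

definition bounded_operators :: "'b cspace \<Rightarrow> 'c cspace \<Rightarrow> ('b \<Rightarrow> 'c) set" where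
  "bounded_operators X Y =
     {T \<in> vecs X \<rightarrow>\<^sub>E vecs Y.
        (\<forall>x\<in>vecs X. \<forall>y\<in>vecs X. T (vadd X x y) = vadd Y (T x) (T y)) \<and>
        (\<forall>c. \<forall>x\<in>vecs X. T (vscale X c x) = vscale Y c (T x)) \<and>
        (\<exists>K. \<forall>x\<in>vecs X. vnorm Y (T x) \<le> K * vnorm X x)}"

definition operator_norm :: "'b cspace \<Rightarrow> 'c cspace \<Rightarrow> ('b \<Rightarrow> 'c) \<Rightarrow> real" where
  "operator_norm X Y T = (SUP x\<in>{x \<in> vecs X. vnorm X x \<le> 1}. vnorm Y (T x))"

definition operator_space :: "'b cspace \<Rightarrow> 'c cspace \<Rightarrow> ('b \<Rightarrow> 'c) cspace" where
  "operator_space X Y =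
     \<lparr>vecs = bounded_operators X Y,
      vadd = (\<lambda>S T. \<lambda>x\<in>vecs X. vadd Y (S x) (T x)),
      vscale = (\<lambda>c T. \<lambda>x\<in>vecs X. vscale Y c (T x)),
      vnorm = operator_norm X Y\<rparr>"

abbreviation dual :: "'b cspace \<Rightarrow> ('b \<Rightarrow> complex) cspace" where
  "dual X \<equiv> operator_space X scalars"

definition hahn_banach_smooth :: "'b set \<Rightarrow> 'b cspace \<Rightarrow> bool" where
  "hahn_banach_smooth S X \<longleftrightarrow>
     closed_subspace X S \<and>
     (\<forall>\<omega>\<^sub>0\<in>vecs (dual (subspace_on X S)).
        \<exists>!\<omega>. \<omega> \<in> vecs (dual X) \<and>
            vnorm (dual X) \<omega> = vnorm (dual (subspace_on X S)) \<omega>\<^sub>0 \<and>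
            restrict \<omega> S = \<omega>\<^sub>0)"

section \<open>Operator algebras on \<open>L\<^sup>p\<close>-spaces\<close>

definition lp_functions :: "real \<Rightarrow> 'x measure \<Rightarrow> ('x \<Rightarrow> complex) set" where
  "lp_functions p M = {f \<in> borel_measurable M. integrable M (\<lambda>x. cmod (f x) powr p)}"

definition lp_class :: "real \<Rightarrow> 'x measure \<Rightarrow> ('x \<Rightarrow> complex) \<Rightarrow> ('x \<Rightarrow> complex) set" where
  "lp_class p M f = {g \<in> lp_functions p M. AE x in M. g x = f x}"

text \<open>The elements of \<open>L\<^sup>p(M)\<close> are classes of functions modulo equality almost everywhere;
  the operations act on chosen representatives.\<close>

definition lp_rep :: "('x \<Rightarrow> complex) set \<Rightarrow> 'x \<Rightarrow> complex" where
  "lp_rep U = (SOME f. f \<in> U)"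

definition lp_space :: "real \<Rightarrow> 'x measure \<Rightarrow> ('x \<Rightarrow> complex) set cspace" where
  "lp_space p M =
     \<lparr>vecs = lp_class p M ` lp_functions p M,
      vadd = (\<lambda>U V. lp_class p M (\<lambda>x. lp_rep U x + lp_rep V x)),
      vscale = (\<lambda>c U. lp_class p M (\<lambda>x. c * lp_rep U x)),
      vnorm = (\<lambda>U. (\<integral>x. cmod (lp_rep U x) powr p \<partial>M) powr (1 / p))\<rparr>"

definition closed_operator_subalgebra :: "'b cspace \<Rightarrow> ('b \<Rightarrow> 'b) set \<Rightarrow> bool" where
  "closed_operator_subalgebra X B \<longleftrightarrow>
     closed_subspace (operator_space X X) B \<and>
     (\<forall>S\<in>B. \<forall>T\<in>B. compose (vecs X) S T \<in> B)"

definition isometric_algebra_iso ::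
    "'b cspace \<Rightarrow> ('b \<Rightarrow> 'b) set \<Rightarrow> ('a::complex_banach_algebra \<Rightarrow> 'b \<Rightarrow> 'b) \<Rightarrow> bool" where
  "isometric_algebra_iso X B \<pi> \<longleftrightarrow>
     bij_betw \<pi> UNIV B \<and>
     (\<forall>a b. \<pi> (a + b) = vadd (operator_space X X) (\<pi> a) (\<pi> b)) \<and>
     (\<forall>c a. \<pi> (scaleC c a) = vscale (operator_space X X) c (\<pi> a)) \<and>
     (\<forall>a b. \<pi> (a * b) = compose (vecs X) (\<pi> a) (\<pi> b)) \<and>
     (\<forall>a. vnorm (operator_space X X) (\<pi> a) = norm a)"

text \<open>The second type argument is the type of points of the measure space; a theorem with a free
  type variable in this place covers every measure space.\<close>

definition lp_operator_algebra ::
    "real \<Rightarrow> 'a::complex_banach_algebra itself \<Rightarrow> 'x itself \<Rightarrow> bool" where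
  "lp_operator_algebra p _ _ \<longleftrightarrow>
     (\<exists>(M :: 'x measure) B (\<pi> :: 'a \<Rightarrow> _).
        closed_operator_subalgebra (lp_space p M) B \<and> isometric_algebra_iso (lp_space p M) B \<pi>)"

section \<open>Contractive approximate identities\<close>

definition directed_set :: "'i set \<Rightarrow> ('i \<Rightarrow> 'i \<Rightarrow> bool) \<Rightarrow> bool" where
  "directed_set \<Lambda> le \<longleftrightarrow>
     \<Lambda> \<noteq> {} \<and> reflp_on \<Lambda> le \<and> transp_on \<Lambda> le \<and>
     (\<forall>s\<in>\<Lambda>. \<forall>t\<in>\<Lambda>. \<exists>u\<in>\<Lambda>. le s u \<and> le t u)"

text \<open>Convergence along this filter is convergence of nets indexed by \<open>\<Lambda>\<close>.\<close>

definition net_filter :: "'i set \<Rightarrow> ('i \<Rightarrow> 'i \<Rightarrow> bool) \<Rightarrow> 'i filter" where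
  "net_filter \<Lambda> le = (INF s\<in>\<Lambda>. principal {t \<in> \<Lambda>. le s t})"

definition contractive_approximate_identity ::
    "'i set \<Rightarrow> ('i \<Rightarrow> 'i \<Rightarrow> bool) \<Rightarrow> ('i \<Rightarrow> 'a::complex_banach_algebra) \<Rightarrow> bool" where
  "contractive_approximate_identity \<Lambda> le e \<longleftrightarrow>
     directed_set \<Lambda> le \<and>
     (\<forall>t\<in>\<Lambda>. norm (e t) \<le> 1) \<and>
     (\<forall>a. ((\<lambda>t. e t * a) \<longlongrightarrow> a) (net_filter \<Lambda> le) \<and>
          ((\<lambda>t. a * e t) \<longlongrightarrow> a) (net_filter \<Lambda> le))"

text \<open>The second type argument is the type containing the index set of the net.\<close>

definition approximately_unital ::
    "'a::complex_banach_algebra itself \<Rightarrow> 'i itself \<Rightarrow> bool" where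
  "approximately_unital _ _ \<longleftrightarrow>
     (\<exists>(\<Lambda> :: 'i set) le (e :: 'i \<Rightarrow> 'a). contractive_approximate_identity \<Lambda> le e)"

section \<open>The multiplier unitization\<close>

definition is_identity :: "'a::complex_banach_algebra \<Rightarrow> bool" where
  "is_identity e \<longleftrightarrow> (\<forall>a. e * a = a \<and> a * e = a)"

text \<open>For an approximately unital algebra other than \<open>{0}\<close>, an identity automatically has norm
  \<open>1\<close>. So dropping the norm condition only affects the zero algebra, which becomes its own
  unitization (the multiplier formula would give its adjoined identity norm \<open>0\<close>).\<close>

definition has_identity :: "'a::complex_banach_algebra itself \<Rightarrow> bool" where
  "has_identity _ \<longleftrightarrow> (\<exists>e::'a. is_identity e)"

text \<open>The pair \<open>(a, \<lambda>)\<close> stands for \<open>a + \<lambda>1\<close>. If \<open>A\<close> has an identity, only the pairs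
  \<open>(a, 0)\<close> are kept, i.e. the unitization is \<open>A\<close> itself.\<close>

definition unitization :: "('a::complex_banach_algebra \<times> complex) cspace" where
  "unitization =
     \<lparr>vecs = (if has_identity TYPE('a) then UNIV \<times> {0} else UNIV),
      vadd = (+),
      vscale = (\<lambda>c (a, l). (scaleC c a, c * l)),
      vnorm = (\<lambda>(a, l). if has_identity TYPE('a) then norm a
                        else (SUP c\<in>{c. norm c \<le> 1}. norm (a * c + scaleC l c)))\<rparr>"

definition unitization_mult ::
    "'a::complex_banach_algebra \<times> complex \<Rightarrow> 'a \<times> complex \<Rightarrow> 'a \<times> complex" where
  "unitization_mult = (\<lambda>(a, l) (b, m). (a * b + scaleC l b + scaleC m a, l * m))"

definition unitization_one :: "'a::complex_banach_algebra \<times> complex" where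
  "unitization_one =
     (if has_identity TYPE('a) then (THE e. is_identity e, 0) else (0, 1))"

definition unitization_embed :: "'a::complex_banach_algebra \<Rightarrow> 'a \<times> complex" where
  "unitization_embed a = (a, 0)"

definition embedded_algebra :: "('a::complex_banach_algebra \<times> complex) set" where
  "embedded_algebra = range unitization_embed"

lemma scaleC_zero_left: "scaleC 0 (x::'a::complex_banach_algebra) = 0"
  using scaleC_of_real[of 0 x] by simp

lemma scaleC_zero_right: "scaleC c (0::'a::complex_banach_algebra) = 0"
  using scaleC_add_right[of c "0::'a" 0] by simp

lemma scaleC_one: "scaleC 1 (x::'a::complex_banach_algebra) = x"
  using scaleC_of_real[of 1 x] by simp

lemma the_identity:
  assumes "has_identity TYPE('a::complex_banach_algebra)"
  shows "is_identity (THE e::'a. is_identity e)"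
proof -
  obtain e :: 'a where "is_identity e"
    using assms by (auto simp: has_identity_def)
  moreover have "f = e" if "is_identity f" for f
    using that \<open>is_identity e\<close> unfolding is_identity_def by metis
  ultimately show ?thesis
    by (rule theI)
qed

lemma unitization_one_identity:
  fixes x :: "'a::complex_banach_algebra \<times> complex"
  shows "(unitization_one :: 'a \<times> complex) \<in> vecs unitization"
    and "x \<in> vecs unitization \<Longrightarrow>
     unitization_mult unitization_one x = x \<and> unitization_mult x unitization_one = x"
  using the_identity[where 'a = 'a]
  by (case_tac [!] x)
    (auto simp: unitization_def unitization_one_def unitization_mult_def is_identity_def
      scaleC_zero_left scaleC_zero_right scaleC_one split: if_splits)

lemma unitization_mult_embed:
  "unitization_mult (unitization_embed a) (unitization_embed b) = unitization_embed (a * b)"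
  by (simp add: unitization_mult_def unitization_embed_def scaleC_zero_left)

end

theory Submission
  imports Defs
begin

text \<open>Both parts come down to estimates on \<open>a + \<lambda>e\<^sub>t\<close> and \<open>a + \<lambda>(1 - e\<^sub>t)\<close>. Since
  \<open>\<parallel>ae\<^sub>t + \<lambda>e\<^sub>t\<parallel> \<le> \<parallel>a + \<lambda>1\<parallel>\<close>, a functional with \<open>\<psi>(e\<^sub>t) \<rightarrow> \<psi>(1)\<close> cannot have larger norm on \<open>A\<^sup>1\<close> than
  on \<open>A\<close>. Conversely, \<open>L\<^sup>p\<close> is uniformly smooth, and \<open>(1 - e\<^sub>t)\<xi>\<close> is asymptotically Birkhoff
  orthogonal to the vectors \<open>a\<eta>\<close> because the \<open>e\<^sub>s\<close> are contractions; hence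
  \<open>\<parallel>a + \<tau>z(1 - e\<^sub>t)\<parallel> \<le> 1 + o(\<tau>)\<close> for \<open>\<parallel>a\<parallel> \<le> 1\<close> and \<open>|z| = 1\<close>. Evaluating a functional that almost
  attains its norm at \<open>a \<in> A\<close> on such elements forces \<open>\<psi>(1 - e\<^sub>t) \<rightarrow> 0\<close>. This gives the uniqueness
  of norm-preserving extensions from \<open>A\<close> to \<open>A\<^sup>1\<close>, and the existence follows by sending \<open>1\<close> to a
  cluster point of \<open>\<omega>\<^sub>0(e\<^sub>t)\<close>.\<close>

section \<open>Uniform smoothness of powers of the norm\<close>

text \<open>Convexity of \<open>x powr p\<close>: its graph lies above its tangents. The tangent
  argument is available only on the open half-line, so \<open>x = 0\<close> and \<open>y = 0\<close>
  are checked separately.\<close>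

lemma powr_above_tangent:
  fixes p x y :: real
  assumes "1 < p" "0 \<le> x" "0 \<le> y"
  shows "x powr p - y powr p \<le> p * x powr (p - 1) * (x - y)"
proof -
  have "x powr p = x powr (p - 1) * x" if "x > 0"
    using that powr_add[of x "p - 1" 1] by simp
  moreover have "p * x powr (p - 1) * (y - x) \<le> y powr p - x powr p" if "x > 0" "y > 0"
    using that assms(1)
    by (intro convex_on_imp_above_tangent[of "{0<..}"] powr_convex)
      (auto intro!: derivative_eq_intros simp: interior_open)
  moreover have "p * x powr (p - 1) * x \<ge> 1 * (x powr (p - 1) * x)" if "x > 0"
    using that assms(1) by (simp only: mult.assoc) (intro mult_right_mono, auto)
  ultimately show ?thesis
    using assms by (cases "x = 0"; cases "y = 0") (auto simp: algebra_simps)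
qed

text \<open>The vector paired with \<open>w - z\<close> is the gradient of
  \<open>norm w powr p\<close>. The scalar tangent inequality at \<open>norm w\<close> transfers
  because \<open>sgn w\<close> has inner product \<open>norm w\<close> with \<open>w\<close> and at
  most \<open>norm z\<close> with \<open>z\<close>.\<close>

lemma norm_powr_gradient_inequality:
  fixes w z :: "'a::real_inner"
  assumes "1 < p"
  shows "norm w powr p - norm z powr p \<le> ((p * norm w powr (p - 1)) *\<^sub>R sgn w) \<bullet> (w - z)"
proof -
  have "sgn w \<bullet> z \<le> norm z"
    using norm_cauchy_schwarz[of "sgn w" z] by (cases "w = 0") (auto simp: norm_sgn)
  moreover have "sgn w \<bullet> w = norm w"
    by (cases "w = 0") (auto simp: sgn_div_norm dot_square_norm power2_eq_square)
  ultimately have "norm w - norm z \<le> sgn w \<bullet> (w - z)"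
    by (simp add: inner_diff_right)
  then have "p * norm w powr (p - 1) * (norm w - norm z) \<le> p * norm w powr (p - 1) * (sgn w \<bullet> (w - z))"
    using assms by (intro mult_left_mono) auto
  then show ?thesis
    using powr_above_tangent[OF assms, of "norm w" "norm z"] by simp
qed

text \<open>Only the origin is delicate: \<open>sgn\<close> jumps there, but it is bounded and the
  positive power of the norm tends to 0.\<close>

lemma continuous_norm_powr_sgn:
  fixes S :: "'a::real_inner set"
  assumes "0 < r"
  shows "continuous_on S (\<lambda>z. (c * norm z powr r) *\<^sub>R sgn z)"
proof (intro continuous_at_imp_continuous_on ballI)
  fix z :: 'a
  show "isCont (\<lambda>z. (c * norm z powr r) *\<^sub>R sgn z) z"
  proof (cases "z = 0")
    case True
    have "((\<lambda>z::'a. norm z powr r) \<longlongrightarrow> 0) (at 0)"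
      by (rule tendsto_zero_powrI[OF tendsto_norm_zero[OF tendsto_ident_at] tendsto_const _ assms])
        simp
    then have lim: "((\<lambda>z::'a. \<bar>c\<bar> * norm z powr r) \<longlongrightarrow> 0) (at 0)"
      by (rule tendsto_mult_right_zero)
    have "norm ((c * norm z powr r) *\<^sub>R sgn z) \<le> \<bar>c\<bar> * norm z powr r" for z :: 'a
      by (simp add: norm_sgn abs_mult)
    then have "((\<lambda>z::'a. (c * norm z powr r) *\<^sub>R sgn z) \<longlongrightarrow> 0) (at 0)"
      by (intro Lim_null_comparison[OF _ lim]) simp
    then show ?thesis
      unfolding isCont_def True by (simp only: sgn_zero scaleR_zero_right)
  next
    case False
    then show ?thesis
      unfolding isCont_def
      by (intro tendsto_scaleR tendsto_mult tendsto_const tendsto_powr tendsto_norm tendsto_sgn tendsto_ident_at)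
        simp_all
  qed
qed

text \<open>The gradient of the p-th power of the norm is uniformly continuous on the compact ball
  of radius 2. Adding the gradient inequalities at \<open>a + \<tau> b\<close> and
  \<open>a - \<tau> b\<close> leaves the difference of two nearby gradients paired with
  \<open>\<tau> b\<close>. Homogeneity then removes the restriction to the unit ball.\<close>

lemma norm_powr_uniformly_smooth:
  fixes \<epsilon> p :: real
  assumes "1 < p" "0 < \<epsilon>"
  shows "\<exists>\<tau>>0. \<forall>a b :: 'a::euclidean_space.
    norm (a + \<tau> *\<^sub>R b) powr p + norm (a - \<tau> *\<^sub>R b) powr p
      \<le> 2 * norm a powr p + \<epsilon> * \<tau> * (norm a powr p + norm b powr p)"
proof -
  define K :: "'a \<Rightarrow> 'a" where "K z = (p * norm z powr (p - 1)) *\<^sub>R sgn z" for z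
  have "uniformly_continuous_on (cball 0 2) K"
    unfolding K_def using assms
    by (intro compact_uniformly_continuous continuous_norm_powr_sgn) auto
  then obtain d where d: "d > 0"
    "\<And>x y. x \<in> cball 0 2 \<Longrightarrow> y \<in> cball 0 2 \<Longrightarrow> dist x y < d \<Longrightarrow> dist (K x) (K y) < \<epsilon>"
    using assms unfolding uniformly_continuous_on_def by metis
  \<comment> \<open>The bound 1 keeps \<open>a + \<tau> b\<close> and \<open>a - \<tau> b\<close> in
    the ball of radius 2; the bound \<open>d / 3\<close> makes their distance, at most
    \<open>2 * \<tau>\<close>, smaller than \<open>d\<close>.\<close>
  define \<tau> where "\<tau> = min 1 (d / 3)"
  have \<tau>: "\<tau> > 0" "\<tau> \<le> 1" "2 * \<tau> < d"
    using d(1) by (auto simp: \<tau>_def min_def)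
  have unit: "norm (a + \<tau> *\<^sub>R b) powr p + norm (a - \<tau> *\<^sub>R b) powr p \<le> 2 * norm a powr p + \<epsilon> * \<tau>"
    if "norm a \<le> 1" "norm b \<le> 1" for a b :: 'a
  proof -
    have tb: "norm (\<tau> *\<^sub>R b) \<le> \<tau>" "norm (\<tau> *\<^sub>R b) \<le> 1"
      using that \<tau> by (auto simp: mult_le_one mult_left_le)
    have "norm (a + \<tau> *\<^sub>R b) powr p - norm a powr p \<le> K (a + \<tau> *\<^sub>R b) \<bullet> (\<tau> *\<^sub>R b)"
      using norm_powr_gradient_inequality[OF assms(1), of "a + \<tau> *\<^sub>R b" a] by (simp add: K_def)
    moreover have "norm (a - \<tau> *\<^sub>R b) powr p - norm a powr p \<le> - (K (a - \<tau> *\<^sub>R b) \<bullet> (\<tau> *\<^sub>R b))"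
      using norm_powr_gradient_inequality[OF assms(1), of "a - \<tau> *\<^sub>R b" a] by (simp add: K_def)
    moreover have "(K (a + \<tau> *\<^sub>R b) - K (a - \<tau> *\<^sub>R b)) \<bullet> (\<tau> *\<^sub>R b) \<le> \<epsilon> * \<tau>"
    proof -
      have "norm (a + \<tau> *\<^sub>R b) \<le> 2" "norm (a - \<tau> *\<^sub>R b) \<le> 2"
        using that(1) tb norm_triangle_ineq[of a "\<tau> *\<^sub>R b"] norm_triangle_ineq4[of a "\<tau> *\<^sub>R b"]
        by linarith+
      moreover have "dist (a + \<tau> *\<^sub>R b) (a - \<tau> *\<^sub>R b) = 2 * norm (\<tau> *\<^sub>R b)"
        using \<tau>(1) unfolding dist_norm by (simp flip: scaleR_2)
      then have "dist (a + \<tau> *\<^sub>R b) (a - \<tau> *\<^sub>R b) < d"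
        using tb(1) \<tau>(3) by linarith
      ultimately have "dist (K (a + \<tau> *\<^sub>R b)) (K (a - \<tau> *\<^sub>R b)) < \<epsilon>"
        by (intro d(2)) (simp_all only: mem_cball_0)
      then have "norm (K (a + \<tau> *\<^sub>R b) - K (a - \<tau> *\<^sub>R b)) \<le> \<epsilon>"
        by (simp add: dist_norm)
      then have "norm (K (a + \<tau> *\<^sub>R b) - K (a - \<tau> *\<^sub>R b)) * norm (\<tau> *\<^sub>R b) \<le> \<epsilon> * \<tau>"
        using tb(1) assms by (intro mult_mono) auto
      then show ?thesis
        using norm_cauchy_schwarz order_trans by blast
    qed
    ultimately show ?thesis
      unfolding inner_diff_left by linarith
  qed
  have "norm (a + \<tau> *\<^sub>R b) powr p + norm (a - \<tau> *\<^sub>R b) powr p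
      \<le> 2 * norm a powr p + \<epsilon> * \<tau> * (norm a powr p + norm b powr p)" for a b :: 'a
  proof (cases "a = 0 \<and> b = 0")
    case False
    \<comment> \<open>Dividing by the larger norm moves both vectors into the unit ball, and every
      term of the inequality scales by the p-th power of \<open>m\<close>.\<close>
    define m where "m = max (norm a) (norm b)"
    have m: "m > 0" "norm a \<le> m" "norm b \<le> m"
      using False by (auto simp: m_def max_def not_le split: if_splits)
    have scale: "norm (x /\<^sub>R m) powr p = norm x powr p / m powr p" for x :: 'a
    proof -
      have "norm (x /\<^sub>R m) = norm x / m"
        using m(1) by (simp add: field_simps)
      then show ?thesis
        using m(1) by (simp add: powr_divide)
    qed
    have "norm (a /\<^sub>R m + \<tau> *\<^sub>R (b /\<^sub>R m)) powr p + norm (a /\<^sub>R m - \<tau> *\<^sub>R (b /\<^sub>R m)) powr p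
        \<le> 2 * norm (a /\<^sub>R m) powr p + \<epsilon> * \<tau>"
      using m by (intro unit) (auto simp: field_simps)
    moreover have "a /\<^sub>R m + \<tau> *\<^sub>R (b /\<^sub>R m) = (a + \<tau> *\<^sub>R b) /\<^sub>R m" "a /\<^sub>R m - \<tau> *\<^sub>R (b /\<^sub>R m) = (a - \<tau> *\<^sub>R b) /\<^sub>R m"
      by (simp_all add: algebra_simps)
    ultimately have *: "norm (a + \<tau> *\<^sub>R b) powr p / m powr p + norm (a - \<tau> *\<^sub>R b) powr p / m powr p
        \<le> 2 * (norm a powr p / m powr p) + \<epsilon> * \<tau>"
      by (simp only: scale)
    have "norm (a + \<tau> *\<^sub>R b) powr p + norm (a - \<tau> *\<^sub>R b) powr p
        \<le> 2 * norm a powr p + \<epsilon> * \<tau> * m powr p"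
    proof -
      have "(norm (a + \<tau> *\<^sub>R b) powr p + norm (a - \<tau> *\<^sub>R b) powr p - 2 * norm a powr p) / m powr p \<le> \<epsilon> * \<tau>"
        using * by (simp add: add_divide_distrib diff_divide_distrib)
      moreover have "m powr p > 0"
        using m(1) by simp
      ultimately show ?thesis
        by (simp add: pos_divide_le_eq)
    qed
    moreover have "m powr p \<le> norm a powr p + norm b powr p"
      by (simp add: m_def max_def)
    then have "\<epsilon> * \<tau> * m powr p \<le> \<epsilon> * \<tau> * (norm a powr p + norm b powr p)"
      using assms \<tau> by (intro mult_left_mono) auto
    ultimately show ?thesis
      by linarith
  qed auto
  with \<tau>(1) show ?thesis
    by blast
qed

text \<open>Convexity at \<open>(x + y) / (\<alpha> + \<beta>)\<close>, which is the mean of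
  \<open>x / \<alpha>\<close> and \<open>y / \<beta>\<close> with weights proportional to
  \<open>\<alpha>\<close> and \<open>\<beta>\<close>. With norms as weights this is the pointwise
  form of the Minkowski inequality.\<close>

lemma powr_add_le_convex_combination:
  fixes x y \<alpha> \<beta> p :: real
  assumes "1 < p" "0 \<le> x" "0 \<le> y" "0 < \<alpha>" "0 < \<beta>"
  shows "(x + y) powr p
    \<le> (\<alpha> + \<beta>) powr p * (\<alpha> / (\<alpha> + \<beta>) * (x powr p / \<alpha> powr p) + \<beta> / (\<alpha> + \<beta>) * (y powr p / \<beta> powr p))"
proof -
  define w u v where "w = (x + y) / (\<alpha> + \<beta>)" and "u = x / \<alpha>" and "v = y / \<beta>"
  \<comment> \<open>Both tangents are taken at the weighted mean \<open>w\<close>, so their linear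
    terms cancel in the weighted sum.\<close>
  have "\<alpha> * (w powr p - u powr p) + \<beta> * (w powr p - v powr p)
      \<le> \<alpha> * (p * w powr (p - 1) * (w - u)) + \<beta> * (p * w powr (p - 1) * (w - v))"
    using assms
    by (intro add_mono mult_left_mono powr_above_tangent) (auto simp: w_def u_def v_def)
  also have "\<dots> = p * w powr (p - 1) * ((\<alpha> + \<beta>) * w - \<alpha> * u - \<beta> * v)"
    by (simp add: algebra_simps)
  also have "(\<alpha> + \<beta>) * w - \<alpha> * u - \<beta> * v = 0"
    using assms by (simp add: w_def u_def v_def)
  finally have "(\<alpha> + \<beta>) * w powr p \<le> \<alpha> * u powr p + \<beta> * v powr p"
    by (simp add: algebra_simps)
  then have "w powr p \<le> (\<alpha> * u powr p + \<beta> * v powr p) / (\<alpha> + \<beta>)"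
    using assms by (simp add: pos_le_divide_eq mult.commute)
  then have "w powr p \<le> \<alpha> / (\<alpha> + \<beta>) * u powr p + \<beta> / (\<alpha> + \<beta>) * v powr p"
    by (simp add: add_divide_distrib)
  moreover have "(x + y) powr p = (\<alpha> + \<beta>) powr p * w powr p"
    using assms by (simp add: w_def powr_divide)
  ultimately show ?thesis
    using assms by (simp add: u_def v_def powr_divide)
qed

section \<open>\<open>L\<^sup>p\<close>-norms and operator norms\<close>

text \<open>Defined on functions rather than classes, so that integral estimates can be made without
  chosen representatives.\<close>

definition lp_norm :: "real \<Rightarrow> 'x measure \<Rightarrow> ('x \<Rightarrow> complex) \<Rightarrow> real" where
  "lp_norm p M f = (\<integral>x. cmod (f x) powr p \<partial>M) powr (1 / p)"

lemma lp_norm_nonneg: "0 \<le> lp_norm p M f"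
  by (simp add: lp_norm_def)

lemma lp_norm_powr:
  assumes "p \<noteq> 0"
  shows "lp_norm p M f powr p = (\<integral>x. cmod (f x) powr p \<partial>M)"
  using assms by (simp add: lp_norm_def powr_powr)

lemma lp_norm_cong_AE:
  assumes "f \<in> borel_measurable M" "g \<in> borel_measurable M" "AE x in M. f x = g x"
  shows "lp_norm p M f = lp_norm p M g"
  unfolding lp_norm_def using assms
  by (intro arg_cong[where f = "\<lambda>I. I powr (1 / p)"] integral_cong_AE) auto

lemma lp_norm_scale: 
  assumes "p \<noteq> 0"
  shows "lp_norm p M (\<lambda>x. c * f x) = cmod c * lp_norm p M f"
  using assms by (simp add: lp_norm_def norm_mult powr_mult powr_powr)

lemma lp_functions_scale:
  assumes "f \<in> lp_functions p M"
  shows "(\<lambda>x. c * f x) \<in> lp_functions p M"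
  using assms by (auto simp: lp_functions_def norm_mult powr_mult)

lemma lp_functions_add:
  assumes "1 < p" "f \<in> lp_functions p M" "g \<in> lp_functions p M"
  shows "(\<lambda>x. f x + g x) \<in> lp_functions p M"
proof -
  have bound: "cmod (f x + g x) powr p \<le> 2 powr p * (cmod (f x) powr p / 2 + cmod (g x) powr p / 2)" for x
  proof -
    have "cmod (f x + g x) powr p \<le> (cmod (f x) + cmod (g x)) powr p"
      using assms(1) by (intro powr_mono2 norm_triangle_ineq) auto
    also have "\<dots> \<le> 2 powr p * (cmod (f x) powr p / 2 + cmod (g x) powr p / 2)"
      using powr_add_le_convex_combination[OF assms(1), of "cmod (f x)" "cmod (g x)" 1 1] by simp
    finally show ?thesis .
  qed
  have [measurable]: "f \<in> borel_measurable M" "g \<in> borel_measurable M"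
    using assms by (auto simp: lp_functions_def)
  have "integrable M (\<lambda>x. 2 powr p * (cmod (f x) powr p / 2 + cmod (g x) powr p / 2))"
    using assms by (auto simp: lp_functions_def)
  then have "integrable M (\<lambda>x. cmod (f x + g x) powr p)"
    by (rule Bochner_Integration.integrable_bound) (use bound in auto)
  then show ?thesis
    by (simp add: lp_functions_def)
qed

text \<open>Integrate the pointwise convexity inequality with the two norms as weights. Adding
  \<open>e / 2\<close> to each keeps the weights positive even when a norm vanishes.\<close>

lemma Minkowski_inequality:
  assumes p: "1 < p" and f: "f \<in> lp_functions p M" and g: "g \<in> lp_functions p M"
  shows "lp_norm p M (\<lambda>x. f x + g x) \<le> lp_norm p M f + lp_norm p M g"
proof (rule field_le_epsilon)
  fix e :: real
  assume "0 < e"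
  define \<alpha> \<beta> where "\<alpha> = lp_norm p M f + e / 2" and "\<beta> = lp_norm p M g + e / 2"
  have pos: "0 < \<alpha>" "0 < \<beta>"
    using \<open>0 < e\<close> lp_norm_nonneg[of p M f] lp_norm_nonneg[of p M g] by (auto simp: \<alpha>_def \<beta>_def)
  have int: "integrable M (\<lambda>x. cmod (f x) powr p)" "integrable M (\<lambda>x. cmod (g x) powr p)"
    "integrable M (\<lambda>x. cmod (f x + g x) powr p)"
    using f g lp_functions_add[OF p f g] by (auto simp: lp_functions_def)
  have le1: "(\<integral>x. cmod (f x) powr p \<partial>M) / \<alpha> powr p \<le> 1" "(\<integral>x. cmod (g x) powr p \<partial>M) / \<beta> powr p \<le> 1"
  proof -
    have "lp_norm p M f powr p \<le> \<alpha> powr p" "lp_norm p M g powr p \<le> \<beta> powr p"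
      using p \<open>0 < e\<close> lp_norm_nonneg by (auto simp: \<alpha>_def \<beta>_def intro!: powr_mono2)
    then show "(\<integral>x. cmod (f x) powr p \<partial>M) / \<alpha> powr p \<le> 1" "(\<integral>x. cmod (g x) powr p \<partial>M) / \<beta> powr p \<le> 1"
      using p pos by (simp_all add: lp_norm_powr)
  qed
  have "(\<integral>x. cmod (f x + g x) powr p \<partial>M)
      \<le> (\<integral>x. (\<alpha> + \<beta>) powr p * (\<alpha> / (\<alpha> + \<beta>) * (cmod (f x) powr p / \<alpha> powr p)
          + \<beta> / (\<alpha> + \<beta>) * (cmod (g x) powr p / \<beta> powr p)) \<partial>M)"
  proof (rule integral_mono)
    fix x
    have "cmod (f x + g x) powr p \<le> (cmod (f x) + cmod (g x)) powr p"
      using p by (intro powr_mono2 norm_triangle_ineq) auto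
    also note powr_add_le_convex_combination[OF p _ _ pos]
    finally show "cmod (f x + g x) powr p \<le> (\<alpha> + \<beta>) powr p * (\<alpha> / (\<alpha> + \<beta>) * (cmod (f x) powr p / \<alpha> powr p)
          + \<beta> / (\<alpha> + \<beta>) * (cmod (g x) powr p / \<beta> powr p))"
      by simp
  qed (use int in auto)
  also have "\<dots> = (\<alpha> + \<beta>) powr p * (\<alpha> / (\<alpha> + \<beta>) * ((\<integral>x. cmod (f x) powr p \<partial>M) / \<alpha> powr p)
      + \<beta> / (\<alpha> + \<beta>) * ((\<integral>x. cmod (g x) powr p \<partial>M) / \<beta> powr p))"
    using int by simp
  also have "\<dots> \<le> (\<alpha> + \<beta>) powr p * (\<alpha> / (\<alpha> + \<beta>) * 1 + \<beta> / (\<alpha> + \<beta>) * 1)"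
    using pos by (intro mult_left_mono add_mono le1) auto
  also have "\<alpha> / (\<alpha> + \<beta>) * 1 + \<beta> / (\<alpha> + \<beta>) * 1 = 1"
    using pos by (simp flip: add_divide_distrib)
  finally have "lp_norm p M (\<lambda>x. f x + g x) powr p \<le> (\<alpha> + \<beta>) powr p"
    using p by (simp add: lp_norm_powr)
  then have "lp_norm p M (\<lambda>x. f x + g x) \<le> \<alpha> + \<beta>"
    using p pos powr_less_mono2[of p "\<alpha> + \<beta>" "lp_norm p M (\<lambda>x. f x + g x)"]
    by (cases "lp_norm p M (\<lambda>x. f x + g x) \<le> \<alpha> + \<beta>") auto
  then show "lp_norm p M (\<lambda>x. f x + g x) \<le> lp_norm p M f + lp_norm p M g + e"
    by (simp add: \<alpha>_def \<beta>_def)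
qed

text \<open>The inequality for complex numbers, regarded as a Euclidean plane, is integrated
  pointwise. Hence one \<open>\<tau>\<close> serves all measures and all functions.\<close>

lemma lp_norm_uniformly_smooth:
  assumes "1 < p" "0 < \<epsilon>"
  shows "\<exists>\<tau>>0. \<forall>(M :: 'x measure) f g. f \<in> lp_functions p M \<longrightarrow> g \<in> lp_functions p M \<longrightarrow>
    lp_norm p M (\<lambda>x. f x + complex_of_real \<tau> * g x) powr p
      + lp_norm p M (\<lambda>x. f x + complex_of_real (- \<tau>) * g x) powr p
    \<le> 2 * lp_norm p M f powr p + \<epsilon> * \<tau> * (lp_norm p M f powr p + lp_norm p M g powr p)"
proof -
  obtain \<tau> where \<tau>: "\<tau> > 0" "\<And>a b :: complex. cmod (a + \<tau> *\<^sub>R b) powr p + cmod (a - \<tau> *\<^sub>R b) powr p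
      \<le> 2 * cmod a powr p + \<epsilon> * \<tau> * (cmod a powr p + cmod b powr p)"
    using norm_powr_uniformly_smooth[OF assms, where 'a = complex] by blast
  have "lp_norm p M (\<lambda>x. f x + complex_of_real \<tau> * g x) powr p
      + lp_norm p M (\<lambda>x. f x + complex_of_real (- \<tau>) * g x) powr p
    \<le> 2 * lp_norm p M f powr p + \<epsilon> * \<tau> * (lp_norm p M f powr p + lp_norm p M g powr p)"
    if f: "f \<in> lp_functions p M" and g: "g \<in> lp_functions p M" for M :: "'x measure" and f g
  proof -
    have int: "integrable M (\<lambda>x. cmod (f x) powr p)" "integrable M (\<lambda>x. cmod (g x) powr p)"
      using f g by (auto simp: lp_functions_def)
    have int': "integrable M (\<lambda>x. cmod (f x + complex_of_real \<tau> * g x) powr p)"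
      "integrable M (\<lambda>x. cmod (f x + complex_of_real (- \<tau>) * g x) powr p)"
      using lp_functions_add[OF assms(1) f lp_functions_scale[OF g]]
      unfolding lp_functions_def by blast+
    have "(\<integral>x. cmod (f x + complex_of_real \<tau> * g x) powr p + cmod (f x + complex_of_real (- \<tau>) * g x) powr p \<partial>M)
        \<le> (\<integral>x. 2 * cmod (f x) powr p + \<epsilon> * \<tau> * (cmod (f x) powr p + cmod (g x) powr p) \<partial>M)"
    proof (rule integral_mono)
      show "cmod (f x + complex_of_real \<tau> * g x) powr p + cmod (f x + complex_of_real (- \<tau>) * g x) powr p
          \<le> 2 * cmod (f x) powr p + \<epsilon> * \<tau> * (cmod (f x) powr p + cmod (g x) powr p)" for x
        using \<tau>(2)[of "f x" "g x"] by (simp add: scaleR_conv_of_real)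
    qed (use int int' in auto)
    then show ?thesis
      using int int' assms(1) by (simp add: lp_norm_powr)
  qed
  with \<tau>(1) show ?thesis
    by blast
qed

section \<open>Norms and operations on classes of functions\<close>

lemma lp_rep_mem:
  assumes "f \<in> lp_functions p M"
  shows "lp_rep (lp_class p M f) \<in> lp_class p M f"
  unfolding lp_rep_def by (rule someI[of _ f]) (use assms in \<open>simp add: lp_class_def\<close>)

lemma lp_rep_lp_functions:
  assumes "U \<in> vecs (lp_space p M)"
  shows "lp_rep U \<in> lp_functions p M"
  using assms lp_rep_mem by (fastforce simp: lp_space_def lp_class_def)

lemma vnorm_lp_space: "vnorm (lp_space p M) U = lp_norm p M (lp_rep U)"
  by (simp add: lp_space_def lp_norm_def)

lemma vnorm_lp_class:
  assumes "f \<in> lp_functions p M"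
  shows "vnorm (lp_space p M) (lp_class p M f) = lp_norm p M f"
  unfolding vnorm_lp_space using lp_rep_mem[OF assms] assms
  by (intro lp_norm_cong_AE) (auto simp: lp_class_def lp_functions_def)

lemma vscale_lp_class: "vscale (lp_space p M) c U = lp_class p M (\<lambda>x. c * lp_rep U x)"
  by (simp add: lp_space_def)

lemma vscale_lp_space:
  assumes "p \<noteq> 0" "U \<in> vecs (lp_space p M)"
  shows "vscale (lp_space p M) c U \<in> vecs (lp_space p M)"
    and "vnorm (lp_space p M) (vscale (lp_space p M) c U) = cmod c * vnorm (lp_space p M) U"
proof -
  have "(\<lambda>x. c * lp_rep U x) \<in> lp_functions p M"
    using assms by (intro lp_functions_scale lp_rep_lp_functions)
  then show "vscale (lp_space p M) c U \<in> vecs (lp_space p M)"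
    "vnorm (lp_space p M) (vscale (lp_space p M) c U) = cmod c * vnorm (lp_space p M) U"
    using assms(1)
    by (simp add: lp_space_def,
        simp only: vscale_lp_class vnorm_lp_class lp_norm_scale[OF assms(1)] vnorm_lp_space[of p M U])
qed

text \<open>The representative chosen for the scaled class agrees with \<open>c * lp_rep V x\<close>
  almost everywhere, and the norm does not see the difference. This moves estimates from functions
  to classes.\<close>

lemma vnorm_vadd_vscale_lp_space:
  assumes "1 < p" "U \<in> vecs (lp_space p M)" "V \<in> vecs (lp_space p M)"
  shows "vnorm (lp_space p M) (vadd (lp_space p M) U (vscale (lp_space p M) c V)) =
    lp_norm p M (\<lambda>x. lp_rep U x + c * lp_rep V x)"
proof -
  have cV: "(\<lambda>x. c * lp_rep V x) \<in> lp_functions p M"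
    using assms by (intro lp_functions_scale lp_rep_lp_functions)
  define W where "W = vscale (lp_space p M) c V"
  have W: "W = lp_class p M (\<lambda>x. c * lp_rep V x)"
    by (simp add: W_def vscale_lp_class)
  have AE: "AE x in M. lp_rep W x = c * lp_rep V x" and Wp: "lp_rep W \<in> lp_functions p M"
    using lp_rep_mem[OF cV] by (auto simp: W lp_class_def)
  have U: "lp_rep U \<in> lp_functions p M"
    using assms by (intro lp_rep_lp_functions)
  have "vnorm (lp_space p M) (vadd (lp_space p M) U W) = lp_norm p M (\<lambda>x. lp_rep U x + lp_rep W x)"
    using vnorm_lp_class[OF lp_functions_add[OF assms(1) U Wp]] by (simp add: lp_space_def)
  also have "\<dots> = lp_norm p M (\<lambda>x. lp_rep U x + c * lp_rep V x)"
    using AE U Wp cV by (intro lp_norm_cong_AE) (auto simp: lp_functions_def)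
  finally show ?thesis
    by (simp add: W_def)
qed

text \<open>No triangle inequality is required: homogeneity alone makes an operator bound on the unit
  ball extend to the whole space.\<close>

definition homogeneous_norm :: "'b cspace \<Rightarrow> bool" where
  "homogeneous_norm X \<longleftrightarrow> (\<forall>x\<in>vecs X. 0 \<le> vnorm X x) \<and>
     (\<forall>c. \<forall>x\<in>vecs X. vscale X c x \<in> vecs X \<and> vnorm X (vscale X c x) = cmod c * vnorm X x)"

lemma homogeneous_norm_lp_space: "p \<noteq> 0 \<Longrightarrow> homogeneous_norm (lp_space p M)"
  by (simp add: homogeneous_norm_def vscale_lp_space) (simp add: vnorm_lp_space lp_norm_nonneg)

lemma homogeneous_norm_scalars: "homogeneous_norm scalars"
  by (simp add: homogeneous_norm_def scalars_def norm_mult)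

lemma operator_norm_upper:
  assumes "homogeneous_norm X" "T \<in> bounded_operators X Y" "x \<in> vecs X" "vnorm X x \<le> 1"
  shows "vnorm Y (T x) \<le> operator_norm X Y T"
proof -
  obtain K where K: "\<forall>x\<in>vecs X. vnorm Y (T x) \<le> K * vnorm X x"
    using assms(2) by (auto simp: bounded_operators_def)
  have "vnorm Y (T x) \<le> \<bar>K\<bar>" if "x \<in> vecs X" "vnorm X x \<le> 1" for x
  proof -
    have "0 \<le> vnorm X x"
      using assms(1) that by (auto simp: homogeneous_norm_def)
    then have "K * vnorm X x \<le> \<bar>K\<bar> * 1"
      using that by (intro mult_mono) auto
    with K that(1) show ?thesis
      by fastforce
  qed
  then have "bdd_above ((\<lambda>x. vnorm Y (T x)) ` {x \<in> vecs X. vnorm X x \<le> 1})"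
    by (intro bdd_aboveI2[of _ _ "\<bar>K\<bar>"]) auto
  then show ?thesis
    unfolding operator_norm_def using assms by (intro cSUP_upper) auto
qed

lemma operator_norm_bound:
  assumes "homogeneous_norm X" "homogeneous_norm Y" "T \<in> bounded_operators X Y" "x \<in> vecs X"
  shows "vnorm Y (T x) \<le> operator_norm X Y T * vnorm X x"
\<comment> \<open>A vector of norm 0 cannot be normalised; there the constant \<open>K\<close> from
  boundedness already forces the image to have norm 0.\<close>
proof (cases "vnorm X x = 0")
  case True
  then show ?thesis
    using assms(3,4) by (force simp: bounded_operators_def)
next
  case False
  define n where "n = vnorm X x"
  define y where "y = vscale X (complex_of_real (1 / n)) x"
  have "n > 0"
    using False assms(1,4) by (auto simp: n_def homogeneous_norm_def less_le)
  have y: "y \<in> vecs X" "vnorm X y = 1"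
    using \<open>n > 0\<close> assms(1,4) by (auto simp: homogeneous_norm_def y_def n_def norm_divide)
  have "T x \<in> vecs Y" "T y = vscale Y (complex_of_real (1 / n)) (T x)"
    using assms(3,4) by (auto simp: bounded_operators_def y_def)
  then have "vnorm Y (T y) = vnorm Y (T x) / n"
    using \<open>n > 0\<close> assms(2) by (simp add: homogeneous_norm_def norm_divide)
  moreover have "vnorm Y (T y) \<le> operator_norm X Y T"
    using operator_norm_upper[OF assms(1,3) y(1)] y(2) by simp
  ultimately show ?thesis
    using \<open>n > 0\<close> by (simp add: pos_divide_le_eq n_def)
qed

lemma operator_norm_least:
  assumes "x\<^sub>0 \<in> vecs X" "vnorm X x\<^sub>0 \<le> 1"
    and "\<And>x. x \<in> vecs X \<Longrightarrow> vnorm X x \<le> 1 \<Longrightarrow> vnorm Y (T x) \<le> r"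
  shows "operator_norm X Y T \<le> r"
  unfolding operator_norm_def using assms by (intro cSUP_least) auto

section \<open>Perturbation of contractions on \<open>L\<^sup>p\<close>\<close>

text \<open>The seminorms are \<open>x \<mapsto> \<parallel>\<pi>(x)\<xi>\<parallel>\<close> for \<open>\<xi>\<close> in the unit ball of the \<open>L\<^sup>p\<close>-space.\<close>

lemma lp_operator_algebra_seminorms:
  assumes p: "1 < p" and "lp_operator_algebra p TYPE('a::complex_banach_algebra) TYPE('x)"
  obtains Q :: "('a::complex_banach_algebra \<Rightarrow> real) set" where
    "\<And>q x. q \<in> Q \<Longrightarrow> 0 \<le> q x"
    "\<And>q x y. q \<in> Q \<Longrightarrow> q (x + y) \<le> q x + q y"
    "\<And>q x y. q \<in> Q \<Longrightarrow> q (x * y) \<le> norm x * q y"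
    "\<And>q x. q \<in> Q \<Longrightarrow> q x \<le> norm x"
    "\<And>x r. (\<And>q. q \<in> Q \<Longrightarrow> q x \<le> r) \<Longrightarrow> norm x \<le> r"
    "\<And>\<epsilon>. 0 < \<epsilon> \<Longrightarrow> \<exists>\<tau>>0. \<forall>q\<in>Q. \<forall>x y.
       q (x + scaleC \<tau> y) powr p + q (x + scaleC (- \<tau>) y) powr p
         \<le> 2 * q x powr p + \<epsilon> * \<tau> * (q x powr p + q y powr p)"
proof -
  obtain M :: "'x measure" and B and \<pi> :: "'a \<Rightarrow> _"
    where "closed_operator_subalgebra (lp_space p M) B" and iso: "isometric_algebra_iso (lp_space p M) B \<pi>"
    using assms(2) by (auto simp: lp_operator_algebra_def)
  define X where "X = lp_space p M"
  define q where "q \<xi> x = vnorm X (\<pi> x \<xi>)" for \<xi> x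
  define Q where "Q = q ` {\<xi> \<in> vecs X. vnorm X \<xi> \<le> 1}"
  have "B \<subseteq> bounded_operators X X"
    using \<open>closed_operator_subalgebra (lp_space p M) B\<close>
    by (auto simp: closed_operator_subalgebra_def closed_subspace_def operator_space_def X_def)
  then have bdd: "\<pi> x \<in> bounded_operators X X" for x
    using iso by (auto simp: isometric_algebra_iso_def bij_betw_def)
  then have in_X: "\<pi> x \<xi> \<in> vecs X" if "\<xi> \<in> vecs X" for x \<xi>
    using that by (fastforce simp: bounded_operators_def)
  have norm_\<pi>: "operator_norm X X (\<pi> x) = norm x" for x
    using iso by (simp add: isometric_algebra_iso_def operator_space_def X_def)
  have mult: "\<pi> (x * y) \<xi> = \<pi> x (\<pi> y \<xi>)" if "\<xi> \<in> vecs X" for x y \<xi>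
    using iso that by (simp add: isometric_algebra_iso_def X_def compose_def)
  have add: "\<pi> (x + scaleC c y) \<xi> = vadd X (\<pi> x \<xi>) (vscale X c (\<pi> y \<xi>))" if "\<xi> \<in> vecs X" for x y c \<xi>
    using iso that by (simp add: isometric_algebra_iso_def X_def operator_space_def)
  have hom: "homogeneous_norm X"
    using p by (simp add: X_def homogeneous_norm_lp_space)
  have q_add: "q \<xi> (x + scaleC c y) = lp_norm p M (\<lambda>t. lp_rep (\<pi> x \<xi>) t + c * lp_rep (\<pi> y \<xi>) t)"
    if "\<xi> \<in> vecs X" for x y c \<xi>
    using in_X[OF that] by (simp add: q_def add[OF that] X_def vnorm_vadd_vscale_lp_space[OF p])
  have q_eq: "q \<xi> x = lp_norm p M (lp_rep (\<pi> x \<xi>))" for \<xi> x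
    by (simp add: q_def X_def vnorm_lp_space)
  have rep: "lp_rep (\<pi> x \<xi>) \<in> lp_functions p M" if "\<xi> \<in> vecs X" for x \<xi>
    using in_X[OF that] by (simp add: X_def lp_rep_lp_functions)
  show ?thesis
  proof (rule that[of Q])
    show "0 \<le> f x" if "f \<in> Q" for f x
      using that by (auto simp: Q_def q_eq lp_norm_nonneg)
    show "f (x + y) \<le> f x + f y" if f: "f \<in> Q" for f x y
    proof -
      obtain \<xi> where \<xi>: "\<xi> \<in> vecs X" "f = q \<xi>"
        using f by (auto simp: Q_def)
      then show ?thesis
        using q_add[OF \<xi>(1), of x 1 y] Minkowski_inequality[OF p rep[OF \<xi>(1), of x] rep[OF \<xi>(1), of y]]
        by (simp add: scaleC_one q_eq)
    qed
    show "f (x * y) \<le> norm x * f y" if "f \<in> Q" for f x y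
      using that operator_norm_bound[OF hom hom bdd] in_X
      by (auto simp: Q_def q_def mult norm_\<pi>[symmetric])
    show "f x \<le> norm x" if "f \<in> Q" for f x
      using that operator_norm_upper[OF hom bdd] by (auto simp: Q_def q_def norm_\<pi>[symmetric])
    show "norm x \<le> r" if bound: "\<And>f. f \<in> Q \<Longrightarrow> f x \<le> r" for x r
    proof -
      \<comment> \<open>The zero class shows that the unit ball is nonempty, so a common bound on it
        bounds the supremum.\<close>
      define U where "U = lp_class p M (\<lambda>_. 0)"
      have "(\<lambda>_. 0) \<in> lp_functions p M"
        by (simp add: lp_functions_def)
      then have "U \<in> vecs X" "vnorm X U \<le> 1"
        unfolding U_def X_def by (auto simp: vnorm_lp_class lp_norm_def) (simp add: lp_space_def)
      moreover have "vnorm X (\<pi> x \<xi>) \<le> r" if "\<xi> \<in> vecs X" "vnorm X \<xi> \<le> 1" for \<xi>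
        using bound[of "q \<xi>"] that unfolding Q_def q_def[symmetric] by blast
      ultimately show ?thesis
        unfolding norm_\<pi>[symmetric] by (rule operator_norm_least)
    qed
    fix \<epsilon> :: real
    assume "0 < \<epsilon>"
    from lp_norm_uniformly_smooth[OF p this, where 'x = 'x] obtain \<tau> where \<tau>: "\<tau> > 0"
      "\<And>f g. f \<in> lp_functions p M \<Longrightarrow> g \<in> lp_functions p M \<Longrightarrow>
        lp_norm p M (\<lambda>x. f x + complex_of_real \<tau> * g x) powr p
          + lp_norm p M (\<lambda>x. f x + complex_of_real (- \<tau>) * g x) powr p
        \<le> 2 * lp_norm p M f powr p + \<epsilon> * \<tau> * (lp_norm p M f powr p + lp_norm p M g powr p)"
      by blast
    have "q \<xi> (x + scaleC \<tau> y) powr p + q \<xi> (x + scaleC (- \<tau>) y) powr p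
         \<le> 2 * q \<xi> x powr p + \<epsilon> * \<tau> * (q \<xi> x powr p + q \<xi> y powr p)" if "\<xi> \<in> vecs X" for \<xi> x y
      using \<tau>(2)[OF rep[OF that, of x] rep[OF that, of y]] unfolding q_add[OF that] by (simp add: q_eq)
    with \<tau>(1) show "\<exists>\<tau>>0. \<forall>f\<in>Q. \<forall>x y. f (x + scaleC \<tau> y) powr p + f (x + scaleC (- \<tau>) y) powr p
         \<le> 2 * f x powr p + \<epsilon> * \<tau> * (f x powr p + f y powr p)"
      by (auto simp: Q_def)
  qed
qed

lemma scaleC_minus_right: "scaleC c (- x :: 'a::complex_banach_algebra) = - scaleC c x"
  using scaleC_add_right[of c x "- x"] by (simp add: scaleC_zero_right eq_neg_iff_add_eq_0 add.commute)

lemma scaleC_diff_right: "scaleC c (x - y :: 'a::complex_banach_algebra) = scaleC c x - scaleC c y"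
  using scaleC_add_right[of c x "- y"] by (simp add: scaleC_minus_right)

lemma scaleC_minus_left: "scaleC (- c) (x :: 'a::complex_banach_algebra) = - scaleC c x"
  using scaleC_add_left[of c "- c" x] by (simp add: scaleC_zero_left eq_neg_iff_add_eq_0 add.commute)

text \<open>Uniform smoothness gives \<open>\<parallel>y + \<tau>h\<parallel> + \<parallel>y - \<tau>h\<parallel> \<le> 2\<parallel>y\<parallel> + o(\<tau>)\<close> for \<open>y = ac\<xi>\<close> and
  \<open>h = z(1 - t)c\<xi>\<close>, while the contraction \<open>s\<close> almost fixes \<open>y\<close> and almost kills \<open>h\<close>, so that
  \<open>\<parallel>y - \<tau>h\<parallel>\<close> is almost at least \<open>\<parallel>y\<parallel>\<close>.\<close>

lemma lp_operator_algebra_perturbation: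
  assumes p: "1 < p" and "lp_operator_algebra p TYPE('a::complex_banach_algebra) TYPE('x)" and "0 < \<epsilon>"
  shows "\<exists>\<tau>>0. \<exists>\<delta>>0. \<forall>(a :: 'a::complex_banach_algebra) s t c (z :: complex). norm a \<le> 1 \<longrightarrow> norm s \<le> 1 \<longrightarrow> norm t \<le> 1 \<longrightarrow>
    norm c \<le> 1 \<longrightarrow> cmod z \<le> 1 \<longrightarrow> norm (s * a - a) \<le> \<delta> \<longrightarrow> norm (s - s * t) \<le> \<delta> \<longrightarrow>
    norm (a * c + scaleC (\<tau> * z) (c - t * c)) \<le> 1 + \<epsilon> * \<tau>"
proof -
  obtain Q :: "('a \<Rightarrow> real) set" where
    nonneg: "\<And>q x. q \<in> Q \<Longrightarrow> 0 \<le> q x" and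
    add: "\<And>q x y. q \<in> Q \<Longrightarrow> q (x + y) \<le> q x + q y" and
    mult: "\<And>q x y. q \<in> Q \<Longrightarrow> q (x * y) \<le> norm x * q y" and
    le_norm: "\<And>q x. q \<in> Q \<Longrightarrow> q x \<le> norm x" and
    norm_le: "\<And>x r. (\<And>q. q \<in> Q \<Longrightarrow> q x \<le> r) \<Longrightarrow> norm x \<le> r" and
    smooth: "\<And>\<epsilon>. 0 < \<epsilon> \<Longrightarrow> \<exists>\<tau>>0. \<forall>q\<in>Q. \<forall>x y.
       q (x + scaleC \<tau> y) powr p + q (x + scaleC (- \<tau>) y) powr p
         \<le> 2 * q x powr p + \<epsilon> * \<tau> * (q x powr p + q y powr p)"
    using lp_operator_algebra_seminorms[OF assms(1,2)] by blast
  \<comment> \<open>Below, \<open>q y \<le> 1\<close> and \<open>q h \<le> 2\<close>, so the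
    smoothness error is at most \<open>\<epsilon>' * \<tau> * (1 + 2 powr p)\<close>; this choice
    makes it half of \<open>\<epsilon> * \<tau>\<close>.\<close>
  define \<epsilon>' where "\<epsilon>' = \<epsilon> / (2 * (1 + 2 powr p))"
  have "(0::real) < 1 + 2 powr p"
    by (simp add: add_pos_nonneg)
  then have "0 < \<epsilon>'" and \<epsilon>': "\<epsilon>' * (1 + 2 powr p) = \<epsilon> / 2"
    using \<open>0 < \<epsilon>\<close> by (simp_all add: \<epsilon>'_def del: distrib_left_numeral)
  from smooth[OF this(1)] obtain \<tau> where "\<tau> > 0" and \<tau>: "\<And>q x y. q \<in> Q \<Longrightarrow>
       q (x + scaleC \<tau> y) powr p + q (x + scaleC (- \<tau>) y) powr p
         \<le> 2 * q x powr p + \<epsilon>' * \<tau> * (q x powr p + q y powr p)"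
    by blast
  \<comment> \<open>The other half of \<open>\<epsilon> * \<tau>\<close> pays for \<open>s\<close>
    acting only approximately: that error is at most \<open>\<delta> * (1 + \<tau>)\<close>, times
    \<open>p\<close> after passing to p-th powers.\<close>
  define \<delta> where "\<delta> = \<epsilon> * \<tau> / (2 * p * (1 + \<tau>))"
  have "\<delta> > 0" and \<delta>: "p * (\<delta> * (1 + \<tau>)) = \<epsilon> / 2 * \<tau>"
    using \<open>\<tau> > 0\<close> \<open>0 < \<epsilon>\<close> p by (simp_all add: \<delta>_def)
  have "norm (a * c + scaleC (\<tau> * z) (c - t * c)) \<le> 1 + \<epsilon> * \<tau>"
    if a: "norm a \<le> 1" and s: "norm s \<le> 1" and t: "norm t \<le> 1" and c: "norm c \<le> 1" and z: "cmod z \<le> 1"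
      and sa: "norm (s * a - a) \<le> \<delta>" and st: "norm (s - s * t) \<le> \<delta>" for a s t c :: 'a and z :: complex
  proof (rule norm_le)
    fix q
    assume q: "q \<in> Q"
    define y h where "y = a * c" and "h = scaleC z (c - t * c)"
    have "norm y \<le> 1 * 1"
      unfolding y_def using a c by (intro order_trans[OF norm_mult_ineq] mult_mono) auto
    then have qy: "q y \<le> 1"
      using le_norm[OF q, of y] by simp
    have "norm (t * c) \<le> 1 * 1"
      using t c by (intro order_trans[OF norm_mult_ineq] mult_mono) auto
    then have "norm (c - t * c) \<le> 2"
      using c norm_triangle_ineq4[of c "t * c"] by linarith
    then have "norm h \<le> 1 * 2"
      unfolding h_def norm_scaleC using z by (intro mult_mono) auto
    then have qh: "q h \<le> 2"
      using le_norm[OF q, of h] by simp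
    \<comment> \<open>\<open>k\<close> is the error in replacing \<open>y\<close> by
      \<open>s * v\<close>: its summands are \<open>y - s * y\<close> and \<open>\<tau>\<close>
      times \<open>s * h\<close>. Since \<open>s\<close> is a contraction, \<open>q v\<close> is at
      least \<open>q y\<close> up to the norm of \<open>k\<close>.\<close>
    define v k where "v = y + scaleC (- \<tau>) h" and "k = (a - s * a) * c + scaleC (\<tau> * z) ((s - s * t) * c)"
    have "y = s * v + k"
      by (simp add: v_def k_def y_def h_def scaleC_scaleC distrib_left left_diff_distrib right_diff_distrib
          mult_scaleC_right scaleC_diff_right scaleC_minus_left mult.assoc)
    have "norm (x * c) \<le> \<delta> * 1" if "norm x \<le> \<delta>" for x
      using c that \<open>\<delta> > 0\<close> by (intro order_trans[OF norm_mult_ineq] mult_mono) auto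
    then have "norm ((a - s * a) * c) \<le> \<delta> * 1" "norm ((s - s * t) * c) \<le> \<delta> * 1"
      using sa st by (simp_all add: norm_minus_commute)
    then have "norm (scaleC (\<tau> * z) ((s - s * t) * c)) \<le> (\<tau> * 1) * \<delta>"
      unfolding norm_scaleC norm_mult using z \<open>\<tau> > 0\<close> by (intro mult_mono) auto
    then have "norm k \<le> \<delta> * (1 + \<tau>)"
      using \<open>norm ((a - s * a) * c) \<le> \<delta> * 1\<close> norm_triangle_ineq[of "(a - s * a) * c" "scaleC (\<tau> * z) ((s - s * t) * c)"]
      by (simp add: k_def algebra_simps)
    have "q (s * v) \<le> q v"
      using mult[OF q, of s v] mult_right_mono[OF s nonneg[OF q, of v]] by linarith
    then have diff: "q y - q v \<le> \<delta> * (1 + \<tau>)"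
      using add[OF q, of "s * v" k] le_norm[OF q, of k] \<open>norm k \<le> \<delta> * (1 + \<tau>)\<close> \<open>y = s * v + k\<close> by simp
    have "q y powr (p - 1) \<le> 1" "q y powr p \<le> 1" "q h powr p \<le> 2 powr p"
      using p qy qh nonneg[OF q] by (auto intro!: powr_mono2 powr_le1)
    have "q y powr p - q v powr p \<le> p * q y powr (p - 1) * (q y - q v)"
      using p nonneg[OF q] by (intro powr_above_tangent) auto
    also have "\<dots> \<le> p * q y powr (p - 1) * (\<delta> * (1 + \<tau>))"
      using p diff by (intro mult_left_mono) auto
    also have "\<dots> \<le> p * 1 * (\<delta> * (1 + \<tau>))"
      using p \<open>q y powr (p - 1) \<le> 1\<close> \<open>\<delta> > 0\<close> \<open>\<tau> > 0\<close> by (intro mult_left_mono mult_right_mono) auto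
    finally have "q y powr p - q v powr p \<le> \<epsilon> / 2 * \<tau>"
      using \<delta> by simp
    moreover have "q (y + scaleC \<tau> h) powr p + q v powr p \<le> 2 * q y powr p + \<epsilon>' * \<tau> * (q y powr p + q h powr p)"
      using \<tau>[OF q, of y h] by (simp add: v_def)
    moreover have "\<epsilon>' * \<tau> * (q y powr p + q h powr p) \<le> \<epsilon>' * \<tau> * (1 + 2 powr p)"
      using \<open>0 < \<epsilon>'\<close> \<open>\<tau> > 0\<close> \<open>q y powr p \<le> 1\<close> \<open>q h powr p \<le> 2 powr p\<close> by (intro mult_left_mono add_mono) auto
    moreover have "\<epsilon>' * \<tau> * (1 + 2 powr p) = \<epsilon> / 2 * \<tau>"
      using \<epsilon>' by (metis mult.assoc mult.commute)
    ultimately have "q (y + scaleC \<tau> h) powr p \<le> 1 + \<epsilon> * \<tau>"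
      using \<open>q y powr p \<le> 1\<close> by linarith
    \<comment> \<open>Above 1 a number is bounded by its p-th power, so the bound on the p-th power
      passes to \<open>q\<close> itself.\<close>
    moreover have "q (y + scaleC \<tau> h) \<le> max 1 (q (y + scaleC \<tau> h) powr p)"
    proof (cases "q (y + scaleC \<tau> h) \<le> 1")
      case False
      then have "q (y + scaleC \<tau> h) powr 1 \<le> q (y + scaleC \<tau> h) powr p"
        using p by (intro powr_mono) auto
      then show ?thesis
        using False by simp
    qed simp
    ultimately have "q (y + scaleC \<tau> h) \<le> 1 + \<epsilon> * \<tau>"
      using mult_pos_pos[OF \<open>0 < \<epsilon>\<close> \<open>\<tau> > 0\<close>] by linarith
    then show "q (a * c + scaleC (\<tau> * z) (c - t * c)) \<le> 1 + \<epsilon> * \<tau>"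
      by (simp add: y_def h_def scaleC_scaleC)
  qed
  with \<open>\<tau> > 0\<close> \<open>\<delta> > 0\<close> show ?thesis
    by blast
qed

section \<open>The multiplier unitization\<close>

lemma vecs_dual: "vecs (dual X) = bounded_operators X scalars"
  and vnorm_dual: "vnorm (dual X) = operator_norm X scalars"
  by (simp_all add: operator_space_def)

lemma bounded_functional_iff:
  "\<psi> \<in> bounded_operators X scalars \<longleftrightarrow> \<psi> \<in> extensional (vecs X) \<and>
     (\<forall>x\<in>vecs X. \<forall>y\<in>vecs X. \<psi> (vadd X x y) = \<psi> x + \<psi> y) \<and>
     (\<forall>c. \<forall>x\<in>vecs X. \<psi> (vscale X c x) = c * \<psi> x) \<and>
     (\<exists>K. \<forall>x\<in>vecs X. cmod (\<psi> x) \<le> K * vnorm X x)"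
  by (auto simp: bounded_operators_def scalars_def PiE_def)

lemma cmod_functional_le:
  assumes "homogeneous_norm X" "\<psi> \<in> bounded_operators X scalars" "x \<in> vecs X"
  shows "cmod (\<psi> x) \<le> operator_norm X scalars \<psi> * vnorm X x"
  using operator_norm_bound[OF assms(1) homogeneous_norm_scalars assms(2,3)] by (simp add: scalars_def)

lemma functional_norm_least:
  assumes "x\<^sub>0 \<in> vecs X" "vnorm X x\<^sub>0 \<le> 1"
    and "\<And>x. x \<in> vecs X \<Longrightarrow> vnorm X x \<le> 1 \<Longrightarrow> cmod (\<psi> x) \<le> r"
  shows "operator_norm X scalars \<psi> \<le> r"
  using assms by (intro operator_norm_least) (auto simp: scalars_def)

lemma subspace_on_simps [simp]:
  "vecs (subspace_on X S) = S" "vadd (subspace_on X S) = vadd X"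
  "vscale (subspace_on X S) = vscale X" "vnorm (subspace_on X S) = vnorm X"
  by (simp_all add: subspace_on_def)

text \<open>Directedness makes the tails of the index set a base of the filter.\<close>

lemma eventually_net_filter:
  assumes "directed_set \<Lambda> le"
  shows "eventually P (net_filter \<Lambda> le) \<longleftrightarrow> (\<exists>s\<in>\<Lambda>. \<forall>t\<in>\<Lambda>. le s t \<longrightarrow> P t)"
proof -
  have "\<exists>u\<in>\<Lambda>. principal {x \<in> \<Lambda>. le u x} \<le> inf (principal {x \<in> \<Lambda>. le s x}) (principal {x \<in> \<Lambda>. le t x})"
    if st: "s \<in> \<Lambda>" "t \<in> \<Lambda>" for s t
  proof -
    obtain u where "u \<in> \<Lambda>" "le s u" "le t u"
      using assms st by (auto simp: directed_set_def)
    then show ?thesis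
      using assms st unfolding directed_set_def by (auto intro!: bexI[of _ u] elim: transp_onD)
  qed
  then show ?thesis
    using assms unfolding net_filter_def
    by (subst eventually_INF_base) (auto simp: directed_set_def eventually_principal)
qed

text \<open>Stated for filters so that passing to a subnet becomes passing to a finer proper filter;
  the construction of extensions relies on this.\<close>

locale approximate_identity =
  fixes F :: "'i filter" and e :: "'i \<Rightarrow> 'a::complex_banach_algebra"
  assumes not_bot: "F \<noteq> bot"
    and contractive: "eventually (\<lambda>t. norm (e t) \<le> 1) F"
    and left: "((\<lambda>t. e t * a) \<longlongrightarrow> a) F"
    and right: "((\<lambda>t. a * e t) \<longlongrightarrow> a) F"

lemma approximate_identity_net:
  assumes "contractive_approximate_identity \<Lambda> le e"
  shows "approximate_identity (net_filter \<Lambda> le) e"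
proof
  have dir: "directed_set \<Lambda> le"
    using assms by (simp add: contractive_approximate_identity_def)
  then have "\<not> eventually (\<lambda>_. False) (net_filter \<Lambda> le)"
    unfolding eventually_net_filter[OF dir] by (auto simp: directed_set_def reflp_on_def)
  then show "net_filter \<Lambda> le \<noteq> bot"
    by (auto simp: trivial_limit_def)
  show "eventually (\<lambda>t. norm (e t) \<le> 1) (net_filter \<Lambda> le)"
    using assms unfolding eventually_net_filter[OF dir]
    by (auto simp: contractive_approximate_identity_def directed_set_def)
qed (use assms in \<open>simp_all add: contractive_approximate_identity_def\<close>)

lemma (in approximate_identity) finer:
  assumes "G \<noteq> bot" "G \<le> F"
  shows "approximate_identity G e"
  using assms contractive left right
  by unfold_locales (auto intro: tendsto_mono filter_leD)

section \<open>The norm of the unitization and the position of the algebra in it\<close>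

lemma embedded_algebra_eq: "embedded_algebra = UNIV \<times> {0}"
  by (auto simp: embedded_algebra_def unitization_embed_def)

lemma unitization_simps [simp]:
  "vadd unitization = (+)" "vscale unitization c (a, l) = (scaleC c a, c * l)"
  by (simp_all add: unitization_def)

lemma vecs_unitization_unital:
  assumes "has_identity TYPE('a::complex_banach_algebra)"
  shows "vecs (unitization :: ('a \<times> complex) cspace) = embedded_algebra"
  using assms by (simp add: unitization_def embedded_algebra_eq)

lemma vecs_unitization_nonunital:
  assumes "\<not> has_identity TYPE('a::complex_banach_algebra)"
  shows "vecs (unitization :: ('a \<times> complex) cspace) = UNIV"
  using assms by (simp add: unitization_def)

lemma embedded_algebra_subset: "embedded_algebra \<subseteq> vecs unitization"
  by (auto simp: unitization_def embedded_algebra_eq)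

text \<open>The supremum defining the norm is bounded by \<open>norm a + cmod l\<close>, so each of
  its members lies below it.\<close>

lemma vnorm_unitization_upper:
  fixes a :: "'a::complex_banach_algebra"
  assumes "\<not> has_identity TYPE('a)" "norm c \<le> 1"
  shows "norm (a * c + scaleC l c) \<le> vnorm unitization (a, l)"
proof -
  have "norm (a * c + scaleC l c) \<le> norm a + cmod l" if "norm c \<le> 1" for c
  proof -
    have "norm (a * c + scaleC l c) \<le> norm a * norm c + cmod l * norm c"
      using norm_triangle_ineq[of "a * c" "scaleC l c"] norm_mult_ineq[of a c] by (simp add: norm_scaleC)
    also have "\<dots> \<le> norm a + cmod l"
      using that by (intro add_mono mult_left_le) auto
    finally show ?thesis .
  qed
  then have "bdd_above ((\<lambda>c. norm (a * c + scaleC l c)) ` {c. norm c \<le> 1})"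
    by (intro bdd_aboveI2) auto
  then show ?thesis
    using assms by (auto simp: unitization_def intro: cSUP_upper)
qed

lemma vnorm_unitization_least:
  fixes a :: "'a::complex_banach_algebra"
  assumes "\<not> has_identity TYPE('a)" "\<And>c. norm c \<le> 1 \<Longrightarrow> norm (a * c + scaleC l c) \<le> r"
  shows "vnorm unitization (a, l) \<le> r"
proof -
  have "{c::'a. norm c \<le> 1} \<noteq> {}"
    by (auto intro!: exI[of _ 0])
  then show ?thesis
    using assms by (auto simp: unitization_def intro!: cSUP_least)
qed

text \<open>In the nonunital case one inequality comes from the supremum; for
  \<open>c \<noteq> 0\<close> the reverse one is the same inequality with the scalar
  \<open>1 / c\<close>. Testing at \<open>c = 0\<close> in the unit ball gives
  nonnegativity.\<close>

lemma homogeneous_norm_unitization: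
  "homogeneous_norm (unitization :: ('a::complex_banach_algebra \<times> complex) cspace)"
proof (cases "has_identity TYPE('a)")
  case True
  then show ?thesis
    by (auto simp: homogeneous_norm_def unitization_def norm_scaleC)
next
  case False
  have le: "vnorm unitization (scaleC c a, c * l) \<le> cmod c * vnorm unitization (a, l)" for a :: 'a and c l
  proof (rule vnorm_unitization_least[OF False])
    fix b :: 'a
    assume "norm b \<le> 1"
    moreover have "scaleC c a * b + scaleC (c * l) b = scaleC c (a * b + scaleC l b)"
      by (simp add: mult_scaleC_left scaleC_add_right scaleC_scaleC)
    ultimately show "norm (scaleC c a * b + scaleC (c * l) b) \<le> cmod c * vnorm unitization (a, l)"
      using vnorm_unitization_upper[OF False] by (simp add: norm_scaleC mult_left_mono)
  qed
  have nonneg: "0 \<le> vnorm unitization (a, l)" for a :: 'a and l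
    using vnorm_unitization_upper[OF False, of 0 a l] by (simp add: scaleC_zero_right)
  have "vnorm unitization (scaleC c a, c * l) = cmod c * vnorm unitization (a, l)" for a :: 'a and c l
  proof (cases "c = 0")
    case True
    then show ?thesis
      using le[of c a l] nonneg[of "scaleC c a" "c * l"] by simp
  next
    case False
    then have "cmod c * vnorm unitization (a, l) \<le> vnorm unitization (scaleC c a, c * l)"
      using le[of "1 / c" "scaleC c a" "c * l"]
      by (simp add: scaleC_scaleC scaleC_one norm_divide field_simps)
    with le[of c a l] show ?thesis
      by simp
  qed
  then show ?thesis
    using False nonneg by (auto simp: homogeneous_norm_def vecs_unitization_nonunital)
qed

lemma homogeneous_norm_subspace:
  assumes "homogeneous_norm X" "S \<subseteq> vecs X" "\<And>c x. x \<in> S \<Longrightarrow> vscale X c x \<in> S"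
  shows "homogeneous_norm (subspace_on X S)"
  using assms by (auto simp: homogeneous_norm_def)

lemma homogeneous_norm_embedded:
  "homogeneous_norm (subspace_on unitization (embedded_algebra :: ('a::complex_banach_algebra \<times> complex) set))"
  by (rule homogeneous_norm_subspace[OF homogeneous_norm_unitization embedded_algebra_subset])
    (auto simp: embedded_algebra_eq)

text \<open>The element \<open>a\<close> is the limit of \<open>a * e t\<close>, and eventually
  \<open>e t\<close> lies in the unit ball.\<close>

lemma (in approximate_identity) norm_le_if_right_multiples:
  assumes "\<And>c. norm c \<le> 1 \<Longrightarrow> norm (a * c) \<le> r"
  shows "norm (a :: 'a) \<le> r"
proof (rule tendsto_upperbound[OF tendsto_norm[OF right] _ not_bot])
  show "eventually (\<lambda>t. norm (a * e t) \<le> r) F"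
    using contractive by eventually_elim (rule assms)
qed

text \<open>The embedding is isometric: submultiplicativity gives one inequality, and right
  multiplication by the approximate identity recovers the norm from the supremum.\<close>

lemma (in approximate_identity) vnorm_embed:
  "vnorm unitization (a, 0) = norm (a :: 'a)"
proof (cases "has_identity TYPE('a)")
  case False
  have "norm a \<le> vnorm unitization (a, 0)"
  proof (rule norm_le_if_right_multiples)
    show "norm (a * c) \<le> vnorm unitization (a, 0)" if "norm c \<le> 1" for c
      using vnorm_unitization_upper[OF False that, of a 0] by (simp add: scaleC_zero_left)
  qed
  moreover have "vnorm unitization (a, 0) \<le> norm a"
  proof (rule vnorm_unitization_least[OF False])
    show "norm (a * c + scaleC 0 c) \<le> norm a" if "norm c \<le> 1" for c
      using norm_mult_ineq[of a c] mult_left_le[OF that norm_ge_zero[of a]] by (simp add: scaleC_zero_left)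
  qed
  ultimately show ?thesis
    by simp
qed (simp add: unitization_def)

text \<open>If \<open>a\<^sub>n \<rightarrow> a + \<lambda>1\<close> with \<open>\<lambda> \<noteq> 0\<close>, then \<open>(a\<^sub>n - a)/\<lambda>\<close> is a Cauchy sequence whose limit is an
  identity of \<open>A\<close>.\<close>

lemma (in approximate_identity) closed_subspace_embedded:
  "closed_subspace unitization (embedded_algebra :: ('a \<times> complex) set)"
proof -
  have "x \<in> embedded_algebra"
    if x: "x \<in> vecs unitization" and s: "\<And>n::nat. s n \<in> embedded_algebra"
      and lim: "(\<lambda>n. vdist unitization (s n) x) \<longlonglongrightarrow> 0" for s and x :: "'a \<times> complex"
  proof (cases "has_identity TYPE('a)")
    case True
    with x show ?thesis
      by (simp add: vecs_unitization_unital)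
  next
    case False
    obtain a l where xal: "x = (a, l)"
      by (cases x)
    show ?thesis
    proof (rule ccontr)
      assume "x \<notin> embedded_algebra"
      then have "l \<noteq> 0"
        by (auto simp: xal embedded_algebra_eq)
      define b where "b n = scaleC (1 / l) (fst (s n) - a)" for n
      define d where "d n = vdist unitization (s n) x / cmod l" for n
      have d_lim: "d \<longlonglongrightarrow> 0"
        unfolding d_def using tendsto_divide_zero[OF lim] .
      have bc: "norm (b n * c - c) \<le> d n" if "norm c \<le> 1" for n c
      proof -
        have "vadd unitization (s n) (vscale unitization (- 1) x) = (fst (s n) - a, - l)"
          using s[of n] by (auto simp: xal embedded_algebra_eq scaleC_minus_left scaleC_one)
        then have "norm ((fst (s n) - a) * c + scaleC (- l) c) \<le> d n * cmod l"
          using vnorm_unitization_upper[OF False that, of "fst (s n) - a" "- l"] \<open>l \<noteq> 0\<close>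
          by (simp add: d_def vdist_def)
        moreover have "b n * c - c = scaleC (1 / l) ((fst (s n) - a) * c + scaleC (- l) c)"
          using \<open>l \<noteq> 0\<close> unfolding b_def mult_scaleC_left
          by (simp add: scaleC_diff_right scaleC_scaleC scaleC_minus_left scaleC_one)
        ultimately show ?thesis
          using \<open>l \<noteq> 0\<close> by (simp add: norm_scaleC norm_divide pos_divide_le_eq)
      qed
      \<comment> \<open>Both \<open>b m\<close> and \<open>b n\<close> nearly fix every
        \<open>c\<close> in the unit ball, and such right multiples determine the norm in the
        algebra.\<close>
      have b_diff: "norm (b m - b n) \<le> d m + d n" for m n
      proof (rule norm_le_if_right_multiples)
        fix c :: 'a
        assume "norm c \<le> 1"
        then show "norm ((b m - b n) * c) \<le> d m + d n"
          using bc[of c m] bc[of c n] norm_triangle_ineq4[of "b m * c - c" "b n * c - c"]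
          by (simp add: left_diff_distrib)
      qed
      have "Cauchy b"
      proof (rule metric_CauchyI)
        fix r :: real
        assume "0 < r"
        then have "eventually (\<lambda>n. d n < r / 2) sequentially"
          using order_tendstoD(2)[OF d_lim, of "r / 2"] by simp
        then obtain N where "\<And>n. n \<ge> N \<Longrightarrow> d n < r / 2"
          by (auto simp: eventually_sequentially)
        then show "\<exists>N. \<forall>m\<ge>N. \<forall>n\<ge>N. dist (b m) (b n) < r"
          using b_diff by (intro exI[of _ N]) (smt (verit) dist_norm field_sum_of_halves)
      qed
      then obtain u where u: "b \<longlonglongrightarrow> u"
        using Cauchy_convergent convergent_def by blast
      have unit_ball: "u * c = c" if "norm c \<le> 1" for c
      proof -
        have "(\<lambda>n. b n * c - c) \<longlonglongrightarrow> 0"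
          using bc[OF that] by (intro Lim_null_comparison[OF _ d_lim]) simp
        moreover have "(\<lambda>n. b n * c - c) \<longlonglongrightarrow> u * c - c"
          by (rule tendsto_diff[OF tendsto_mult_right[OF u] tendsto_const])
        ultimately show ?thesis
          using LIMSEQ_unique by fastforce
      qed
      have u_left: "u * c = c" for c
      proof (cases "c = 0")
        case False
        then have "u * (c /\<^sub>R norm c) = c /\<^sub>R norm c"
          by (intro unit_ball) simp
        with False show ?thesis
          by simp
      qed simp
      \<comment> \<open>As \<open>u\<close> is a left identity, \<open>e t = u * e t\<close>, which
        tends to \<open>u\<close>. Then \<open>c * e t\<close> tends both to \<open>c * u\<close>
        and to \<open>c\<close>, so \<open>u\<close> is a right identity as well.\<close>
      have "(e \<longlongrightarrow> u) F"
        using right[of u] by (simp add: u_left)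
      then have "c * u = c" for c
        using tendsto_unique[OF not_bot tendsto_mult_left right] by blast
      with u_left have "is_identity u"
        by (simp add: is_identity_def)
      with False show False
        by (auto simp: has_identity_def)
    qed
  qed
  then show ?thesis
    using embedded_algebra_subset
    by (auto simp: closed_subspace_def embedded_algebra_eq)
qed

section \<open>Norm-preserving extensions\<close>

lemma bounded_operators_restrict:
  assumes "\<psi> \<in> bounded_operators X scalars" "closed_subspace X S"
  shows "restrict \<psi> S \<in> bounded_operators (subspace_on X S) scalars"
proof -
  obtain K where "\<forall>x\<in>vecs X. cmod (\<psi> x) \<le> K * vnorm X x"
    using assms(1) by (auto simp: bounded_functional_iff)
  then have "\<forall>x\<in>S. cmod (restrict \<psi> S x) \<le> K * vnorm X x"
    using assms(2) by (auto simp: closed_subspace_def)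
  then have "\<exists>K. \<forall>x\<in>S. cmod (restrict \<psi> S x) \<le> K * vnorm X x"
    by blast
  with assms show ?thesis
    unfolding bounded_functional_iff closed_subspace_def by (auto simp: subset_eq)
qed

lemma cnj_sgn_mult: "cnj (sgn w) * w = cmod w"
proof (cases "w = 0")
  case False
  then show ?thesis
    using complex_norm_square[of w]
    by (simp add: sgn_div_norm scaleR_conv_of_real power2_eq_square field_simps)
qed simp

text \<open>The left side is the limit of \<open>\<omega>\<close> at \<open>a + l * e t\<close>. The
  norm of that element exceeds the norm of \<open>a * e t + l * e t\<close>, hence the unitization
  norm of \<open>(a, l)\<close>, by at most \<open>norm (a - a * e t)\<close>, which tends to 0. The
  lemma serves both for a given functional and for building an extension with value \<open>L\<close>
  at the identity.\<close>

lemma (in approximate_identity) extension_bound: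
  fixes \<omega> :: "'a \<times> complex \<Rightarrow> complex"
  assumes nonunital: "\<not> has_identity TYPE('a)"
    and \<omega>: "\<omega> \<in> bounded_operators (subspace_on unitization embedded_algebra) scalars"
    and lim: "((\<lambda>t. \<omega> (e t, 0)) \<longlongrightarrow> L) F"
  shows "cmod (\<omega> (a, 0) + l * L)
    \<le> operator_norm (subspace_on unitization embedded_algebra) scalars \<omega> * vnorm unitization (a, l)"
proof -
  define N where "N = operator_norm (subspace_on unitization embedded_algebra) scalars \<omega>"
  have bound: "cmod (\<omega> (b, 0)) \<le> N * norm b" for b
    using cmod_functional_le[OF homogeneous_norm_embedded \<omega>, of "(b, 0)"]
    by (simp add: N_def embedded_algebra_eq vnorm_embed)
  have "N \<ge> 0"
    unfolding N_def
    using operator_norm_upper[OF homogeneous_norm_embedded \<omega>, of "(0, 0)"]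
    by (simp add: embedded_algebra_eq vnorm_embed) (simp add: scalars_def order_trans[OF norm_ge_zero])
  have lin: "\<omega> (b + scaleC l c, 0) = \<omega> (b, 0) + l * \<omega> (c, 0)" for b c
  proof -
    have "\<omega> ((b, 0) + vscale unitization l (c, 0)) = \<omega> (b, 0) + \<omega> (vscale unitization l (c, 0))"
      "\<omega> (vscale unitization l (c, 0)) = l * \<omega> (c, 0)"
      using \<omega> by (auto simp: bounded_functional_iff embedded_algebra_eq)
    then show ?thesis
      by simp
  qed
  have "((\<lambda>t. cmod (\<omega> (a, 0) + l * \<omega> (e t, 0))) \<longlongrightarrow> cmod (\<omega> (a, 0) + l * L)) F"
    by (intro tendsto_intros lim)
  moreover have "((\<lambda>t. N * (vnorm unitization (a, l) + norm (a - a * e t))) \<longlongrightarrow> N * (vnorm unitization (a, l) + norm (a - a))) F"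
    by (intro tendsto_intros right)
  moreover have "eventually (\<lambda>t. cmod (\<omega> (a, 0) + l * \<omega> (e t, 0)) \<le> N * (vnorm unitization (a, l) + norm (a - a * e t))) F"
    using contractive
  proof eventually_elim
    case (elim t)
    have "norm (a + scaleC l (e t)) \<le> norm (a * e t + scaleC l (e t)) + norm (a - a * e t)"
      using norm_triangle_ineq[of "a * e t + scaleC l (e t)" "a - a * e t"] by (simp add: add.commute)
    also have "\<dots> \<le> vnorm unitization (a, l) + norm (a - a * e t)"
      using vnorm_unitization_upper[OF nonunital elim] by simp
    finally have "N * norm (a + scaleC l (e t)) \<le> N * (vnorm unitization (a, l) + norm (a - a * e t))"
      using \<open>N \<ge> 0\<close> by (rule mult_left_mono)
    with bound[of "a + scaleC l (e t)"] show ?case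
      by (simp add: lin)
  qed
  ultimately show ?thesis
    using tendsto_le[OF not_bot] by (force simp: N_def)
qed

context approximate_identity
begin

context
  fixes \<psi> :: "'a \<times> complex \<Rightarrow> complex"
  assumes nonunital: "\<not> has_identity TYPE('a)"
    and \<psi>: "\<psi> \<in> bounded_operators unitization scalars"
begin

lemma functional_linear: "\<psi> ((a, k) + (scaleC c b, c * l)) = \<psi> (a, k) + c * \<psi> (b, l)"
proof -
  have "\<psi> ((a, k) + vscale unitization c (b, l)) = \<psi> (a, k) + \<psi> (vscale unitization c (b, l))"
    using \<psi> unfolding bounded_functional_iff vecs_unitization_nonunital[OF nonunital] unitization_simps(1)
    by blast
  also have "\<psi> (vscale unitization c (b, l)) = c * \<psi> (b, l)"
    using \<psi> unfolding bounded_functional_iff vecs_unitization_nonunital[OF nonunital] by blast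
  finally show ?thesis
    by simp
qed

lemma functional_decompose: "\<psi> (a, l) = \<psi> (a, 0) + l * \<psi> (0, 1)"
  using functional_linear[of a 0 l 0 1] by (simp add: scaleC_zero_right)

lemma functional_norm_restrict_le:
  "operator_norm (subspace_on unitization embedded_algebra) scalars (restrict \<psi> embedded_algebra)
    \<le> operator_norm unitization scalars \<psi>"
proof (rule functional_norm_least[of "(0, 0)"])
  fix x :: "'a \<times> complex"
  assume "x \<in> vecs (subspace_on unitization embedded_algebra)"
    "vnorm (subspace_on unitization embedded_algebra) x \<le> 1"
  then show "cmod (restrict \<psi> embedded_algebra x) \<le> operator_norm unitization scalars \<psi>"
    using operator_norm_upper[OF homogeneous_norm_unitization \<psi>, of x] embedded_algebra_subset
    by (auto simp: scalars_def)
qed (simp_all add: embedded_algebra_eq vnorm_embed)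

text \<open>Under the assumption, \<open>\<psi>\<close> is the extension of its own restriction with
  value \<open>L = \<psi> (0, 1)\<close> at the identity, so \<open>extension_bound\<close> controls
  its norm.\<close>

lemma norm_eq_if_tendsto:
  assumes "((\<lambda>t. \<psi> (e t, 0)) \<longlongrightarrow> \<psi> (0, 1)) F"
  shows "operator_norm unitization scalars \<psi>
    = operator_norm (subspace_on unitization embedded_algebra) scalars (restrict \<psi> embedded_algebra)"
proof (rule antisym[OF _ functional_norm_restrict_le])
  define N where "N = operator_norm (subspace_on unitization embedded_algebra) scalars (restrict \<psi> embedded_algebra)"
  have restr: "restrict \<psi> embedded_algebra \<in> bounded_operators (subspace_on unitization embedded_algebra) scalars"
    by (rule bounded_operators_restrict[OF \<psi> closed_subspace_embedded])
  have "0 \<le> N"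
    using operator_norm_upper[OF homogeneous_norm_embedded restr, of "(0, 0)"]
    unfolding N_def by (simp add: embedded_algebra_eq vnorm_embed) (simp add: scalars_def order_trans[OF norm_ge_zero])
  have bound: "cmod (\<psi> (a, l)) \<le> N * vnorm unitization (a, l)" for a l
    using extension_bound[OF nonunital restr, of "\<psi> (0, 1)" a l] assms
    unfolding functional_decompose[of a l] N_def by (simp add: embedded_algebra_eq)
  show "operator_norm unitization scalars \<psi> \<le> N"
  proof (rule functional_norm_least[of "(0, 0)"])
    fix x :: "'a \<times> complex"
    assume "vnorm unitization x \<le> 1"
    then have "N * vnorm unitization x \<le> N"
      using \<open>0 \<le> N\<close> by (rule mult_left_le)
    then show "cmod (\<psi> x) \<le> N"
      using bound[of "fst x" "snd x"] by simp
  qed (simp_all add: vnorm_embed vecs_unitization_nonunital[OF nonunital])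
qed

text \<open>Test \<open>\<psi>\<close> on \<open>a + \<tau>z(1 - e\<^sub>t)\<close>, whose norm is at most \<open>1 + \<epsilon>\<tau>\<close>, where \<open>a\<close> in the unit ball of
  \<open>A\<close> almost attains the norm of \<open>\<psi>\<close> and \<open>z\<close> is the phase that aligns \<open>\<psi>(1 - e\<^sub>t)\<close>.\<close>

lemma tendsto_if_norm_eq:
  assumes p: "1 < p" and lp: "lp_operator_algebra p TYPE('a) TYPE('x)"
    and eq: "operator_norm unitization scalars \<psi>
      = operator_norm (subspace_on unitization embedded_algebra) scalars (restrict \<psi> embedded_algebra)"
  shows "((\<lambda>t. \<psi> (e t, 0)) \<longlongrightarrow> \<psi> (0, 1)) F"
proof (rule tendstoI)
  fix r :: real
  assume "0 < r"
  define N where "N = operator_norm unitization scalars \<psi>"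
  have bound: "cmod (\<psi> x) \<le> N * vnorm unitization x" for x
    using cmod_functional_le[OF homogeneous_norm_unitization \<psi>, of x]
    by (simp add: N_def vecs_unitization_nonunital[OF nonunital])
  have "0 \<le> N"
    using operator_norm_upper[OF homogeneous_norm_unitization \<psi>, of "(0, 0)"]
    by (simp add: N_def vecs_unitization_nonunital[OF nonunital] vnorm_embed)
      (simp add: scalars_def order_trans[OF norm_ge_zero])
  have zero: "\<psi> (0, 0) = 0"
    using functional_linear[of 0 0 1 0 0] by (simp add: scaleC_zero_right)
  \<comment> \<open>The final estimate bounds the distance by
    \<open>N * \<epsilon> + \<epsilon>\<close>; the summand 1 keeps the denominator positive when
    \<open>N = 0\<close>.\<close>
  define \<epsilon> where "\<epsilon> = r / 2 / (N + 1)"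
  have "(N + 1) * \<epsilon> = r / 2"
    using \<open>0 \<le> N\<close> by (simp add: \<epsilon>_def del: divide_divide_eq_left)
  then have "N * \<epsilon> + \<epsilon> < r"
    using \<open>0 < r\<close> by (simp add: distrib_right)
  have "0 < \<epsilon>"
    using \<open>0 < r\<close> \<open>0 \<le> N\<close> by (simp add: \<epsilon>_def)
  obtain \<tau> \<delta> where "0 < \<tau>" "0 < \<delta>" and perturb: "\<And>(a :: 'a) s t c (z :: complex). norm a \<le> 1 \<Longrightarrow> norm s \<le> 1 \<Longrightarrow>
      norm t \<le> 1 \<Longrightarrow> norm c \<le> 1 \<Longrightarrow> cmod z \<le> 1 \<Longrightarrow> norm (s * a - a) \<le> \<delta> \<Longrightarrow> norm (s - s * t) \<le> \<delta> \<Longrightarrow>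
      norm (a * c + scaleC (\<tau> * z) (c - t * c)) \<le> 1 + \<epsilon> * \<tau>"
    using lp_operator_algebra_perturbation[OF p lp \<open>0 < \<epsilon>\<close>] by blast
  \<comment> \<open>Here the equality of norms enters: \<open>N\<close> is already the supremum over
    the unit ball of the algebra. The tolerance \<open>\<epsilon> * \<tau>\<close> is matched to the
    perturbation bound so that dividing by \<open>\<tau>\<close> still leaves a small
    quantity.\<close>
  obtain b where b: "norm b \<le> 1" "cmod (\<psi> (b, 0)) > N - \<epsilon> * \<tau>"
  proof (rule ccontr)
    assume "\<not> thesis"
    with that have le: "cmod (\<psi> (b, 0)) \<le> N - \<epsilon> * \<tau>" if "norm b \<le> 1" for b
      using \<open>norm b \<le> 1\<close> by force
    have "N \<le> N - \<epsilon> * \<tau>"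
      unfolding N_def eq
    proof (rule functional_norm_least[of "(0, 0)"], unfold N_def[symmetric] eq[symmetric])
      fix x :: "'a \<times> complex"
      assume "x \<in> vecs (subspace_on unitization embedded_algebra)"
        "vnorm (subspace_on unitization embedded_algebra) x \<le> 1"
      then show "cmod (restrict \<psi> embedded_algebra x) \<le> N - \<epsilon> * \<tau>"
        using le by (auto simp: embedded_algebra_eq vnorm_embed)
    qed (simp_all add: embedded_algebra_eq vnorm_embed)
    then show False
      using mult_pos_pos[OF \<open>0 < \<epsilon>\<close> \<open>0 < \<tau>\<close>] by linarith
  qed
  define a where "a = scaleC (cnj (sgn (\<psi> (b, 0)))) b"
  have "norm a \<le> 1"
    using b(1) by (simp add: a_def norm_scaleC norm_sgn)
  have \<psi>a: "\<psi> (a, 0) = cmod (\<psi> (b, 0))"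
    using functional_linear[of 0 0 "cnj (sgn (\<psi> (b, 0)))" b 0] zero
    by (simp add: a_def cnj_sgn_mult)
  have "eventually (\<lambda>s. dist (e s * a) a < \<delta>) F"
    using left \<open>0 < \<delta>\<close> by (rule tendstoD)
  then have "eventually (\<lambda>s. norm (e s) \<le> 1 \<and> norm (e s * a - a) \<le> \<delta>) F"
    using contractive by eventually_elim (simp add: dist_norm)
  then obtain s where s: "norm (e s) \<le> 1" "norm (e s * a - a) \<le> \<delta>"
    using eventually_happens'[OF not_bot] by blast
  \<comment> \<open>The index \<open>s\<close> is fixed first, adapted to \<open>a\<close>; only
    \<open>t\<close> then runs along the filter.\<close>
  have "eventually (\<lambda>t. dist (e s * e t) (e s) < \<delta>) F"
    using right \<open>0 < \<delta>\<close> by (rule tendstoD)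
  then show "eventually (\<lambda>t. dist (\<psi> (e t, 0)) (\<psi> (0, 1)) < r) F"
    using contractive
  proof eventually_elim
    case (elim t)
    define w where "w = \<psi> (0, 1) - \<psi> (e t, 0)"
    define z where "z = cnj (sgn w)"
    have "cmod z \<le> 1"
      by (simp add: z_def norm_sgn)
    define x where "x = (a + scaleC (\<tau> * z) (- e t), \<tau> * z)"
    have "vnorm unitization x \<le> 1 + \<epsilon> * \<tau>"
      unfolding x_def
    proof (rule vnorm_unitization_least[OF nonunital])
      fix c :: 'a
      assume "norm c \<le> 1"
      have "norm (e s - e s * e t) \<le> \<delta>"
        using elim(1) by (simp add: dist_norm norm_minus_commute)
      from perturb[OF \<open>norm a \<le> 1\<close> s(1) elim(2) \<open>norm c \<le> 1\<close> \<open>cmod z \<le> 1\<close> s(2) this]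
      show "norm ((a + scaleC (\<tau> * z) (- e t)) * c + scaleC (\<tau> * z) c) \<le> 1 + \<epsilon> * \<tau>"
        by (simp add: distrib_right mult_scaleC_left scaleC_minus_right scaleC_diff_right algebra_simps)
    qed
    then have "cmod (\<psi> x) \<le> N * (1 + \<epsilon> * \<tau>)"
      using bound[of x] mult_left_mono[OF _ \<open>0 \<le> N\<close>] order_trans by blast
    moreover have "\<psi> x = cmod (\<psi> (b, 0)) + \<tau> * cmod w"
    proof -
      have "\<psi> (- e t, 1) = w"
        using functional_linear[of 0 1 "- 1" "e t" 0] by (simp add: w_def scaleC_minus_left scaleC_one)
      moreover have "\<psi> x = \<psi> (a, 0) + (\<tau> * z) * \<psi> (- e t, 1)"
        using functional_linear[of a 0 "\<tau> * z" "- e t" 1] by (simp add: x_def)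
      moreover have "z * w = cmod w"
        by (simp add: z_def cnj_sgn_mult)
      ultimately show ?thesis
        by (simp add: \<psi>a mult.assoc)
    qed
    then have "cmod (\<psi> x) = cmod (\<psi> (b, 0)) + \<tau> * cmod w"
      using \<open>0 < \<tau>\<close> by (simp add: abs_of_nonneg flip: of_real_mult of_real_add)
    \<comment> \<open>The phases add up without cancellation, so
      \<open>N - \<epsilon> * \<tau> + \<tau> * cmod w\<close> is less than
      \<open>N * (1 + \<epsilon> * \<tau>)\<close>.\<close>
    ultimately have "\<tau> * cmod w < \<tau> * (N * \<epsilon> + \<epsilon>)"
      using b(2) by (simp add: algebra_simps)
    then have "cmod w < r"
      using \<open>0 < \<tau>\<close> \<open>N * \<epsilon> + \<epsilon> < r\<close> by simp
    then show ?case
      by (simp add: w_def dist_norm norm_minus_commute)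
  qed
qed

end

end

section \<open>The unital case, existence and uniqueness of extensions\<close>

text \<open>If \<open>u\<close> is the identity, then \<open>e t = e t * u\<close> tends to
  \<open>u\<close> in norm, and \<open>\<psi>\<close> is continuous.\<close>

lemma tendsto_unitization_one:
  fixes \<psi> :: "'a::complex_banach_algebra \<times> complex \<Rightarrow> complex"
  assumes "approximate_identity F e" "has_identity TYPE('a)" "\<psi> \<in> bounded_operators unitization scalars"
  shows "((\<lambda>t. \<psi> (e t, 0)) \<longlongrightarrow> \<psi> unitization_one) F"
proof -
  interpret approximate_identity F e
    by fact
  define u :: 'a where "u = (THE u. is_identity u)"
  have "is_identity u"
    unfolding u_def by (rule the_identity[OF assms(2)])
  then have lim: "(e \<longlongrightarrow> u) F"
    using left[of u] by (simp add: is_identity_def)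
  have bound: "cmod (\<psi> (b, 0)) \<le> operator_norm unitization scalars \<psi> * norm b" for b
    using cmod_functional_le[OF homogeneous_norm_unitization assms(3), of "(b, 0)"]
    by (simp add: vecs_unitization_unital[OF assms(2)] embedded_algebra_eq vnorm_embed)
  have "\<psi> (e t - u, 0) = \<psi> (e t, 0) - \<psi> (u, 0)" for t
  proof -
    have "(e t - u, 0 :: complex) \<in> vecs unitization" "(u, 0 :: complex) \<in> vecs unitization"
      by (simp_all add: vecs_unitization_unital[OF assms(2)] embedded_algebra_eq)
    then have "\<psi> ((e t - u, 0) + (u, 0)) = \<psi> (e t - u, 0) + \<psi> (u, 0)"
      using assms(3) unfolding bounded_functional_iff unitization_simps(1) by blast
    then show ?thesis
      by simp
  qed
  then have diff: "norm (\<psi> (e t, 0) - \<psi> (u, 0)) \<le> operator_norm unitization scalars \<psi> * norm (e t - u)" for t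
    using bound[of "e t - u"] by simp
  have "((\<lambda>t. operator_norm unitization scalars \<psi> * norm (e t - u)) \<longlongrightarrow> 0) F"
    using tendsto_norm_zero[OF LIM_zero[OF lim]] by (rule tendsto_mult_right_zero)
  then have "((\<lambda>t. \<psi> (e t, 0) - \<psi> (u, 0)) \<longlongrightarrow> 0) F"
    by (rule Lim_null_comparison[OF always_eventually, rotated]) (use diff in simp)
  then show ?thesis
    using assms(2) by (simp add: LIM_zero_iff unitization_one_def u_def)
qed

text \<open>When the algebra has an identity it is its own unitization and both sides hold;
  otherwise the two implications were shown above.\<close>

lemma approximate_identity_tendsto_iff:
  fixes \<psi> :: "'a::complex_banach_algebra \<times> complex \<Rightarrow> complex"
  assumes "1 < p" "lp_operator_algebra p TYPE('a) TYPE('x)"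
    and ai: "approximate_identity F e" and \<psi>: "\<psi> \<in> bounded_operators unitization scalars"
  shows "((\<lambda>t. \<psi> (e t, 0)) \<longlongrightarrow> \<psi> unitization_one) F \<longleftrightarrow>
    operator_norm unitization scalars \<psi> =
      operator_norm (subspace_on unitization embedded_algebra) scalars (restrict \<psi> embedded_algebra)"
proof (cases "has_identity TYPE('a)")
  case True
  have "subspace_on unitization embedded_algebra = (unitization :: ('a \<times> complex) cspace)"
    using vecs_unitization_unital[OF True] by (simp add: subspace_on_def)
  moreover have "restrict \<psi> embedded_algebra = \<psi>"
    using \<psi> vecs_unitization_unital[OF True]
    by (auto simp: bounded_functional_iff intro: extensional_restrict)
  ultimately show ?thesis
    using tendsto_unitization_one[OF ai True \<psi>] by simp
next
  case False
  then show ?thesis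
    using approximate_identity.norm_eq_if_tendsto[OF ai False \<psi>]
      approximate_identity.tendsto_if_norm_eq[OF ai False \<psi> assms(1,2)]
    by (auto simp: unitization_one_def)
qed

text \<open>The values of \<open>\<omega>\<^sub>0\<close> along the approximate identity stay in a
  compact disc, so they have a cluster point \<open>L\<close>. On a finer filter they converge to
  \<open>L\<close>, and \<open>L\<close> can be taken as the value at the identity.\<close>

lemma (in approximate_identity) norm_preserving_extension:
  fixes \<omega>\<^sub>0 :: "'a \<times> complex \<Rightarrow> complex"
  assumes nonunital: "\<not> has_identity TYPE('a)"
    and \<omega>\<^sub>0: "\<omega>\<^sub>0 \<in> bounded_operators (subspace_on unitization embedded_algebra) scalars"
  shows "\<exists>\<omega>\<in>bounded_operators unitization scalars.
    operator_norm unitization scalars \<omega> = operator_norm (subspace_on unitization embedded_algebra) scalars \<omega>\<^sub>0 \<and>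
    restrict \<omega> embedded_algebra = \<omega>\<^sub>0"
proof -
  define N where "N = operator_norm (subspace_on unitization embedded_algebra) scalars \<omega>\<^sub>0"
  define G where "G = filtermap (\<lambda>t. \<omega>\<^sub>0 (e t, 0)) F"
  have "eventually (\<lambda>t. cmod (\<omega>\<^sub>0 (e t, 0)) \<le> N) F"
    using contractive
  proof eventually_elim
    case (elim t)
    then show ?case
      using operator_norm_upper[OF homogeneous_norm_embedded \<omega>\<^sub>0, of "(e t, 0)"]
      by (simp add: N_def embedded_algebra_eq vnorm_embed) (simp add: scalars_def)
  qed
  then have "eventually (\<lambda>z. z \<in> cball 0 N) G"
    by (simp add: G_def eventually_filtermap)
  moreover have "G \<noteq> bot"
    using not_bot by (simp add: G_def filtermap_bot_iff)
  ultimately obtain L where L: "inf (nhds L) G \<noteq> bot"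
    using compact_cball[of "0 :: complex" N] unfolding compact_filter by blast
  \<comment> \<open>The coarsest filter finer than \<open>F\<close> along which the values tend to
    \<open>L\<close>. It is proper because otherwise some neighbourhood of \<open>L\<close> would
    eventually be avoided, contradicting that \<open>L\<close> is a cluster point.\<close>
  define H where "H = inf F (filtercomap (\<lambda>t. \<omega>\<^sub>0 (e t, 0)) (nhds L))"
  have "H \<noteq> bot"
  proof
    assume "H = bot"
    then have "eventually (\<lambda>_. False) (inf F (filtercomap (\<lambda>t. \<omega>\<^sub>0 (e t, 0)) (nhds L)))"
      by (simp add: H_def)
    then obtain P Q where "eventually P F" "eventually Q (filtercomap (\<lambda>t. \<omega>\<^sub>0 (e t, 0)) (nhds L))"
      "\<And>t. P t \<Longrightarrow> Q t \<Longrightarrow> False"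
      unfolding eventually_inf by blast
    moreover from this(2) obtain R where "eventually R (nhds L)" "\<And>t. R (\<omega>\<^sub>0 (e t, 0)) \<Longrightarrow> Q t"
      unfolding eventually_filtercomap by blast
    ultimately have "eventually (\<lambda>t. \<not> R (\<omega>\<^sub>0 (e t, 0))) F" and "eventually R (nhds L)"
      by (blast intro: eventually_mono)+
    then have "eventually (\<lambda>z. \<not> R z) G"
      by (simp add: G_def eventually_filtermap)
    with \<open>eventually R (nhds L)\<close> have "eventually (\<lambda>_. False) (inf (nhds L) G)"
      unfolding eventually_inf by blast
    with L show False
      by (simp add: trivial_limit_def)
  qed
  then interpret H: approximate_identity H e
    by (rule finer) (simp add: H_def)
  have lim: "((\<lambda>t. \<omega>\<^sub>0 (e t, 0)) \<longlongrightarrow> L) H"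
    unfolding H_def filterlim_iff_le_filtercomap by simp
  define \<omega> where "\<omega> x = \<omega>\<^sub>0 (fst x, 0) + snd x * L" for x
  have lin: "\<omega>\<^sub>0 (a + b, 0) = \<omega>\<^sub>0 (a, 0) + \<omega>\<^sub>0 (b, 0)" "\<omega>\<^sub>0 (scaleC c a, 0) = c * \<omega>\<^sub>0 (a, 0)" for a b c
  proof -
    have mem: "(a, 0) \<in> embedded_algebra" "(b, 0) \<in> embedded_algebra"
      by (simp_all add: embedded_algebra_eq)
    then have "\<omega>\<^sub>0 ((a, 0) + (b, 0)) = \<omega>\<^sub>0 (a, 0) + \<omega>\<^sub>0 (b, 0)"
      using \<omega>\<^sub>0 unfolding bounded_functional_iff subspace_on_simps unitization_simps(1) by blast
    moreover have "\<omega>\<^sub>0 (vscale unitization c (a, 0)) = c * \<omega>\<^sub>0 (a, 0)"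
      using \<omega>\<^sub>0 mem unfolding bounded_functional_iff subspace_on_simps by blast
    ultimately show "\<omega>\<^sub>0 (a + b, 0) = \<omega>\<^sub>0 (a, 0) + \<omega>\<^sub>0 (b, 0)" "\<omega>\<^sub>0 (scaleC c a, 0) = c * \<omega>\<^sub>0 (a, 0)"
      by simp_all
  qed
  have "cmod (\<omega> x) \<le> N * vnorm unitization x" for x
    using H.extension_bound[OF nonunital \<omega>\<^sub>0 lim, of "fst x" "snd x"] by (simp add: \<omega>_def N_def)
  then have "\<exists>K. \<forall>x. cmod (\<omega> x) \<le> K * vnorm unitization x"
    by blast
  moreover have "\<omega> (x + y) = \<omega> x + \<omega> y" "\<omega> (vscale unitization c x) = c * \<omega> x" for x y c
    by (cases x; simp add: \<omega>_def lin algebra_simps)+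
  ultimately have \<omega>: "\<omega> \<in> bounded_operators unitization scalars"
    unfolding bounded_functional_iff vecs_unitization_nonunital[OF nonunital] unitization_simps(1)
    by simp
  have restr: "restrict \<omega> embedded_algebra = \<omega>\<^sub>0"
  proof
    fix x
    show "restrict \<omega> embedded_algebra x = \<omega>\<^sub>0 x"
      using \<omega>\<^sub>0 unfolding bounded_functional_iff
      by (cases x) (auto simp: \<omega>_def embedded_algebra_eq extensional_def restrict_def)
  qed
  have "((\<lambda>t. \<omega> (e t, 0)) \<longlongrightarrow> \<omega> (0, 1)) H"
    using lim lin(2)[of 0 0] by (simp add: \<omega>_def scaleC_zero_left)
  then have "operator_norm unitization scalars \<omega> = N"
    using H.norm_eq_if_tendsto[OF nonunital \<omega>] by (simp add: restr N_def)
  with \<omega> restr show ?thesis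
    by (auto simp: N_def)
qed

text \<open>For uniqueness in the nonunital case, two norm-preserving extensions agree on the
  algebra, and their values at the identity are both the limit of \<open>\<omega>\<^sub>0\<close>
  along the same approximate identity.\<close>

lemma hahn_banach_smooth_unitization:
  assumes "1 < p" "lp_operator_algebra p TYPE('a::complex_banach_algebra) TYPE('x)"
    and ai: "approximate_identity F (e :: 'i \<Rightarrow> 'a)"
  shows "hahn_banach_smooth (embedded_algebra :: ('a \<times> complex) set) unitization"
proof -
  interpret approximate_identity F e
    by fact
  have "\<exists>!\<omega>. \<omega> \<in> bounded_operators unitization scalars \<and>
      operator_norm unitization scalars \<omega> = operator_norm (subspace_on unitization embedded_algebra) scalars \<omega>\<^sub>0 \<and>
      restrict \<omega> embedded_algebra = \<omega>\<^sub>0"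
    if \<omega>\<^sub>0: "\<omega>\<^sub>0 \<in> bounded_operators (subspace_on unitization embedded_algebra) scalars"
    for \<omega>\<^sub>0 :: "'a \<times> complex \<Rightarrow> complex"
  proof (cases "has_identity TYPE('a)")
    case True
    have eq: "subspace_on unitization embedded_algebra = (unitization :: ('a \<times> complex) cspace)"
      using vecs_unitization_unital[OF True] by (simp add: subspace_on_def)
    have "restrict \<omega> embedded_algebra = \<omega>" if "\<omega> \<in> bounded_operators unitization scalars"
      for \<omega> :: "'a \<times> complex \<Rightarrow> complex"
      using that vecs_unitization_unital[OF True]
      by (auto simp: bounded_functional_iff intro: extensional_restrict)
    then show ?thesis
      using \<omega>\<^sub>0 unfolding eq by (intro ex1I[of _ \<omega>\<^sub>0]) auto
  next
    case False
    show ?thesis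
    proof (rule ex_ex1I)
      show "\<exists>\<omega>. \<omega> \<in> bounded_operators unitization scalars \<and>
          operator_norm unitization scalars \<omega> = operator_norm (subspace_on unitization embedded_algebra) scalars \<omega>\<^sub>0 \<and>
          restrict \<omega> embedded_algebra = \<omega>\<^sub>0"
        using norm_preserving_extension[OF False \<omega>\<^sub>0] by blast
    next
      fix \<omega> \<omega>'
      assume A: "\<omega> \<in> bounded_operators unitization scalars \<and>
          operator_norm unitization scalars \<omega> = operator_norm (subspace_on unitization embedded_algebra) scalars \<omega>\<^sub>0 \<and>
          restrict \<omega> embedded_algebra = \<omega>\<^sub>0"
        and A': "\<omega>' \<in> bounded_operators unitization scalars \<and>
          operator_norm unitization scalars \<omega>' = operator_norm (subspace_on unitization embedded_algebra) scalars \<omega>\<^sub>0 \<and>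
          restrict \<omega>' embedded_algebra = \<omega>\<^sub>0"
      have "\<omega> (a, 0) = \<omega>\<^sub>0 (a, 0)" "\<omega>' (a, 0) = \<omega>\<^sub>0 (a, 0)" for a
        using A A' by (metis embedded_algebra_eq mem_Sigma_iff UNIV_I insertI1 restrict_apply')+
      moreover have "((\<lambda>t. \<omega> (e t, 0)) \<longlongrightarrow> \<omega> (0, 1)) F" "((\<lambda>t. \<omega>' (e t, 0)) \<longlongrightarrow> \<omega>' (0, 1)) F"
        using A A' tendsto_if_norm_eq[OF False _ assms(1,2)] by auto
      ultimately have "\<omega> (0, 1) = \<omega>' (0, 1)" "\<And>a. \<omega> (a, 0) = \<omega>' (a, 0)"
        using tendsto_unique[OF not_bot] by auto
      then have "\<omega> (a, l) = \<omega>' (a, l)" for a l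
        using functional_decompose[OF False] A A' by metis
      then show "\<omega> = \<omega>'"
        by auto
    qed
  qed
  then show ?thesis
    unfolding hahn_banach_smooth_def vecs_dual vnorm_dual using closed_subspace_embedded by blast
qed

theorem proposition4p24:
  fixes p :: real
  assumes "1 < p"
    and "lp_operator_algebra p TYPE('a::complex_banach_algebra) TYPE('x)"
    and "approximately_unital TYPE('a) TYPE('i)"
  shows "(\<forall>(\<Lambda> :: 'j set) le (e :: 'j \<Rightarrow> 'a).
            contractive_approximate_identity \<Lambda> le e \<longrightarrow>
            (\<forall>\<psi>\<in>vecs (dual unitization).
               ((\<lambda>t. \<psi> (unitization_embed (e t))) \<longlongrightarrow> \<psi> unitization_one) (net_filter \<Lambda> le) \<longleftrightarrow>
               vnorm (dual unitization) \<psi> =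
                 vnorm (dual (subspace_on unitization embedded_algebra)) (restrict \<psi> embedded_algebra)))
         \<and> hahn_banach_smooth (embedded_algebra :: ('a \<times> complex) set) unitization"
proof
  show "\<forall>(\<Lambda> :: 'j set) le (e :: 'j \<Rightarrow> 'a).
            contractive_approximate_identity \<Lambda> le e \<longrightarrow>
            (\<forall>\<psi>\<in>vecs (dual unitization).
               ((\<lambda>t. \<psi> (unitization_embed (e t))) \<longlongrightarrow> \<psi> unitization_one) (net_filter \<Lambda> le) \<longleftrightarrow>
               vnorm (dual unitization) \<psi> =
                 vnorm (dual (subspace_on unitization embedded_algebra)) (restrict \<psi> embedded_algebra))"
    unfolding vecs_dual vnorm_dual unitization_embed_def
    using approximate_identity_tendsto_iff[OF assms(1,2) approximate_identity_net] by blast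
  \<comment> \<open>Smoothness does not mention a net; the one used in its proof is supplied by
    \<open>approximately_unital\<close>.\<close>
  show "hahn_banach_smooth (embedded_algebra :: ('a \<times> complex) set) unitization"
    using assms(3) hahn_banach_smooth_unitization[OF assms(1,2) approximate_identity_net]
    unfolding approximately_unital_def by blast
qed

end
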